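(* Let $n\ge1$, let $p_1,\dots,p_n\in(0,1)$, and let $Q_1,\dots,Q_n$ be probability distributions on $\mathbb{N}=\{1,2,\ldots\}$ with finite means $q_1,\dots,q_n$. Let $S_n=\sum_{i=1}^n Y_i$ with $Y_i=B_iX_i$, where $X_1,\dots,X_n,B_1,\dots,B_n$ are mutually independent, $X_i$ has distribution $Q_i$, and $B_i$ is Bernoulli with parameter $p_i$. Let $\lambda=\sum_{i=1}^np_i$, $Q=\sum_{i=1}^n\frac{p_i}{\lambda}Q_i$, $q=\sum_{i=1}^n\frac{p_i}{\lambda}q_i$, and let $P_{S_n}$ be the distribution of $S_n$. Then $$d_{\mathrm{TV}}\big(P_{S_n},\mathrm{CPo}(\lambda,Q)\big)\;\le\;H(\lambda,Q)\,q\left\{\left[\sum_{i=1}^n\frac{p_i^3}{1-p_i}\right]^{1/2}+D(\mathbf{Q})\right\},$$ where $$D(\mathbf{Q})=\sum_{j=1}^\infty\sum_{i=1}^n\frac{j\,p_i}{q}\,|Q_i(j)-Q(j)|$$ and $H(\lambda,Q)$ is the Stein factor.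
   Context: For $\lambda>0$ and a probability distribution $Q$ on $\mathbb{N}=\{1,2,\ldots\}$, the compound Poisson distribution $\mathrm{CPo}(\lambda,Q)$ is the distribution of $\sum_{i=1}^Z X_i$, where $Z$ is Poisson with parameter $\lambda$ and the $X_i$ are i.i.d. with distribution $Q$, independent of $Z$ (the empty sum is $0$). Total variation distance between distributions on $\mathbb{Z}_+=\{0,1,2,\ldots\}$: $d_{\mathrm{TV}}(P,P')=\frac12\sum_{x\in\mathbb{Z}_+}|P(x)-P'(x)|=\max_{A\subset\mathbb{Z}_+}|P(A)-P'(A)|$. Stein factor $H(\lambda,Q)$: if the sequence $\{jQ(j)\}_{j\ge1}$ is non-increasing, set $\delta=[\lambda\{Q(1)-2Q(2)\}]^{-1}$ (with $\delta=+\infty$ if $Q(1)=2Q(2)$) and let $H(\lambda,Q)=1$ if $\delta\ge1$, $H(\lambda,Q)=\sqrt\delta\,(2-\sqrt\delta)$ if $\delta<1$. Otherwise $H(\lambda,Q)=e^\lambda\min\{1,\frac1{\lambda Q(1)}\}$ (with $\frac{1}{\lambda Q(1)}=+\infty$ if $Q(1)=0$). *)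

theory Defs
  imports "HOL-Probability.Probability" "HOL-Probability.Product_PMF"
begin

text \<open>Distributions on \<open>{1,2,\<dots>}\<close> are rendered as \<^typ>\<open>nat pmf\<close> with no mass at \<open>0\<close>.\<close>

definition mixture_pmf :: "'i set \<Rightarrow> ('i \<Rightarrow> real) \<Rightarrow> ('i \<Rightarrow> 'a pmf) \<Rightarrow> 'a pmf" where
  "mixture_pmf I w Q = embed_pmf (\<lambda>x. \<Sum>i\<in>I. w i * pmf (Q i) x)"

lemma pmf_mixture_pmf:
  assumes "\<And>i. i \<in> I \<Longrightarrow> 0 \<le> w i" and "(\<Sum>i\<in>I. w i) = 1"
  shows "pmf (mixture_pmf I w Q) x = (\<Sum>i\<in>I. w i * pmf (Q i) x)"
  unfolding mixture_pmf_def
proof (rule pmf_embed_pmf)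
  show "0 \<le> (\<Sum>i\<in>I. w i * pmf (Q i) y)" for y
    using assms by (intro sum_nonneg) auto
  have "(\<integral>\<^sup>+y. ennreal (\<Sum>i\<in>I. w i * pmf (Q i) y) \<partial>count_space UNIV)
      = (\<integral>\<^sup>+y. (\<Sum>i\<in>I. ennreal (w i) * ennreal (pmf (Q i) y)) \<partial>count_space UNIV)"
    using assms by (intro nn_integral_cong) (simp add: sum_ennreal[symmetric] ennreal_mult)
  also have "\<dots> = (\<Sum>i\<in>I. ennreal (w i) * (\<integral>\<^sup>+y. ennreal (pmf (Q i) y) \<partial>count_space UNIV))"
    by (simp add: nn_integral_sum nn_integral_cmult)
  also have "\<dots> = (\<Sum>i\<in>I. ennreal (w i))"
    by (simp add: nn_integral_pmf)
  also have "\<dots> = 1"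
    using assms by (simp add: sum_ennreal)
  finally show "(\<integral>\<^sup>+y. ennreal (\<Sum>i\<in>I. w i * pmf (Q i) y) \<partial>count_space UNIV) = 1" .
qed

text \<open>Conditionally on \<open>Z = z\<close>, a sum of \<open>z\<close> independent summands with distribution \<open>Q\<close>.\<close>

definition compound_poisson_pmf :: "real \<Rightarrow> nat pmf \<Rightarrow> nat pmf" where
  "compound_poisson_pmf lam Q =
     bind_pmf (poisson_pmf lam)
       (\<lambda>z. map_pmf (\<lambda>x. \<Sum>i=1..z. x i) (Pi_pmf {1..z} 0 (\<lambda>_. Q)))"

definition tv_dist :: "nat measure \<Rightarrow> nat measure \<Rightarrow> real" where
  "tv_dist P P' = 1 / 2 * (\<Sum>\<^sub>\<infinity>x\<in>UNIV. \<bar>measure P {x} - measure P' {x}\<bar>)"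

text \<open>The separate cases \<open>Q(1) = 2 Q(2)\<close> and \<open>Q(1) = 0\<close> are those where the reciprocals
  are to be read as \<open>+\<infinity>\<close>, rather than as \<open>1 / 0 = 0\<close>.\<close>

definition stein_factor :: "real \<Rightarrow> nat pmf \<Rightarrow> real" where
  "stein_factor lam Q =
     (if \<forall>j\<ge>1. real (j + 1) * pmf Q (j + 1) \<le> real j * pmf Q j then
        (if pmf Q 1 = 2 * pmf Q 2 then 1
         else let \<delta> = 1 / (lam * (pmf Q 1 - 2 * pmf Q 2)) in
           if \<delta> \<ge> 1 then 1 else sqrt \<delta> * (2 - sqrt \<delta>))
      else exp lam * (if pmf Q 1 = 0 then 1 else min 1 (1 / (lam * pmf Q 1))))"

end

(*
  Let P be the law of the sum, L the generating function of the weights lam * Q(j), and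
  D = L' P - P' (as generating functions), so that D vanishes when P is compound Poisson.

  Writing P and its derivative through the leave-one-out sums gives
    D = Q' sum_i p_i (P - P_i) - sum_i p_i (Q_i' - Q') P_i,
  where P_i is the law of the sum without its i-th term. The l1 norm of the second part is at
  most q D(Q); the first part is q times the l1 norm of E[W; S = .] for the centred variable
  W = sum_i p_i (1 - [B_i = 0] / (1 - p_i)), whose variance is sum_i p_i^3 / (1 - p_i).

  It remains to bound the total variation distance by the Stein factor times the l1 norm of D.
  In general one solves the recursion for the coefficients of P and majorises it by the compound
  Poisson weights. If j Q(j) is non-increasing, then with w = 1 - u + u z the path
  P(w) exp (L(z) - L(w)) joins the compound Poisson law (u = 0) to P (u = 1), and its
  u-derivative is (1 - z) exp (L(z) - L(w)) D(w).
  Here exp (L(z) - L(w)) contains a Poisson factor of mean m = theta (1 - u), where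
  theta = lam (Q(1) - 2 Q(2)), so that the factor 1 - z costs min (2, 1 / sqrt m) in l1 norm.
  Integrating over u bounds the distance by min (1, 1 / sqrt theta), which is at most the
  Stein factor because sqrt delta <= 1 implies sqrt delta <= sqrt delta (2 - sqrt delta).
*)
theory Submission
  imports Defs "HOL-Analysis.FPS_Convergence"
begin

unbundle fps_syntax
no_notation vec_nth (infixl \<open>$\<close> 90)
no_notation Infinite_Set_Sum.abs_summable_on (infix \<open>abs'_summable'_on\<close> 50)

subsection \<open>Absolutely summable power series\<close>

text \<open>Only finite means are available, so generating functions need not extend beyond [-1, 1],
  and the laws and their derivatives are merely absolutely summable. The work is therefore done in
  the Banach algebra of such series, and identities are checked by evaluation on (0, 1). The
  substitution w = 1 - u + u z keeps the argument in [-1, 1] and acts on laws as binomial thinning,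
  a contraction of the l1 norm. With u = exp (-t) the path is that of the immigration-death process
  behind the Stein equation, applied to the ratio P / exp L. Only half of an l1 norm is paid in
  total variation, because a multiple of 1 - z has total mass zero; this turns 1 / sqrt m into 1 /
  (2 sqrt m), whose singularity at u = 1 is integrable. The variable W arises because P_i is the
  conditional law of the sum given B_i = 0: the indicator of that event divided by 1 - p_i
  represents P_i as a reweighting of the law of the sum itself, so that Cauchy-Schwarz replaces a
  sum of separate distances by one standard deviation.\<close>

definition l1 :: "real fps \<Rightarrow> bool" where
  "l1 f \<longleftrightarrow> summable (\<lambda>n. \<bar>f $ n\<bar>)"

definition l1_norm :: "real fps \<Rightarrow> real" where
  "l1_norm f = (\<Sum>n. \<bar>f $ n\<bar>)"

lemma l1_norm_nonneg: "l1 f \<Longrightarrow> 0 \<le> l1_norm f"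
  by (auto simp: l1_norm_def l1_def intro: suminf_nonneg)

text \<open>Fubini for double series: summability of the absolute row sums makes the array summable
  over pairs, where order is immaterial. Passing through \<open>infsum\<close> is harmless, as it
  agrees with \<open>suminf\<close> on absolutely convergent sequences.\<close>

lemma summable_swap_real:
  fixes c :: "nat \<Rightarrow> nat \<Rightarrow> real"
  assumes row: "\<And>k. summable (\<lambda>i. \<bar>c k i\<bar>)" and tot: "summable (\<lambda>k. \<Sum>i. \<bar>c k i\<bar>)"
  shows "summable (\<lambda>k. \<bar>c k i\<bar>)"
    and "summable (\<lambda>i. \<Sum>k. \<bar>c k i\<bar>)"
    and "(\<Sum>i. \<Sum>k. c k i) = (\<Sum>k. \<Sum>i. c k i)"
    and "(\<Sum>i. \<Sum>k. \<bar>c k i\<bar>) = (\<Sum>k. \<Sum>i. \<bar>c k i\<bar>)"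
proof -
  have inf_eq: "infsum f UNIV = suminf f" if "summable (\<lambda>n. \<bar>f n\<bar>)" for f :: "nat \<Rightarrow> real"
    using norm_summable_imp_has_sum[of f "suminf f"] that
    by (simp add: infsumI summable_rabs_cancel summable_sums)
  have son: "f summable_on UNIV" if "summable (\<lambda>n. \<bar>f n\<bar>)" for f :: "nat \<Rightarrow> real"
    using that norm_summable_imp_summable_on[of f] by simp
  have abs: "(\<lambda>(k,i). c k i) abs_summable_on (UNIV \<times> UNIV)"
    unfolding Infinite_Sum.abs_summable_on_Sigma_iff
  proof (intro conjI ballI)
    fix k show "(\<lambda>y. norm (case (k, y) of (k, i) \<Rightarrow> c k i)) summable_on UNIV"
      using row[of k] by (simp add: son)
  next
    have "(\<lambda>k. \<Sum>i. \<bar>c k i\<bar>) summable_on UNIV"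
      using tot row by (intro son) (simp add: suminf_nonneg)
    then show "(\<lambda>x. \<Sum>\<^sub>\<infinity>y. norm (case (x, y) of (k, i) \<Rightarrow> c k i)) abs_summable_on UNIV"
      using row by (simp add: inf_eq suminf_nonneg)
  qed
  then have abs': "(\<lambda>(i,k). c k i) abs_summable_on (UNIV \<times> UNIV)"
    using summable_on_swap[of "\<lambda>(k,i). \<bar>c k i\<bar>" UNIV UNIV] by (simp add: case_prod_unfold)
  then have col: "(\<lambda>k. c k i) abs_summable_on UNIV" for i
    using Infinite_Sum.abs_summable_on_Sigma_iff[of "\<lambda>(i,k). c k i" UNIV "\<lambda>_. UNIV"] by auto
  then show col': "summable (\<lambda>k. \<bar>c k i\<bar>)" for i
    using summable_on_imp_summable by fastforce
  have "(\<lambda>i. \<Sum>\<^sub>\<infinity>k. \<bar>c k i\<bar>) abs_summable_on UNIV"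
    using abs' Infinite_Sum.abs_summable_on_Sigma_iff[of "\<lambda>(i,k). c k i" UNIV "\<lambda>_. UNIV"] by auto
  then have "(\<lambda>i. \<Sum>k. \<bar>c k i\<bar>) abs_summable_on UNIV"
    using col' by (simp add: inf_eq)
  then have "(\<lambda>i. \<Sum>k. \<bar>c k i\<bar>) summable_on UNIV"
    by (rule abs_summable_summable)
  then show tot': "summable (\<lambda>i. \<Sum>k. \<bar>c k i\<bar>)"
    by (rule summable_on_imp_summable)
  have le: "\<bar>\<Sum>i. f i\<bar> \<le> (\<Sum>i. \<bar>f i\<bar>)" if "summable (\<lambda>n. \<bar>f n\<bar>)" for f :: "nat \<Rightarrow> real"
    using summable_rabs[OF that] .
  have s1: "summable (\<lambda>k. \<bar>\<Sum>i. c k i\<bar>)"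
    by (rule summable_comparison_test'[OF tot]) (use le row in simp)
  have s2: "summable (\<lambda>i. \<bar>\<Sum>k. c k i\<bar>)"
    by (rule summable_comparison_test'[OF tot']) (use le col' in simp)
  have "(\<Sum>\<^sub>\<infinity>i. \<Sum>\<^sub>\<infinity>k. c k i) = (\<Sum>\<^sub>\<infinity>k. \<Sum>\<^sub>\<infinity>i. c k i)"
    using infsum_swap_banach[OF abs_summable_summable[OF abs']] .
  then show "(\<Sum>i. \<Sum>k. c k i) = (\<Sum>k. \<Sum>i. c k i)"
    using row col' s1 s2 by (simp add: inf_eq)
  have "(\<lambda>(i,k). \<bar>c k i\<bar>) summable_on UNIV \<times> UNIV"
    using abs' by (simp add: case_prod_unfold)
  then have "(\<Sum>\<^sub>\<infinity>i. \<Sum>\<^sub>\<infinity>k. \<bar>c k i\<bar>) = (\<Sum>\<^sub>\<infinity>k. \<Sum>\<^sub>\<infinity>i. \<bar>c k i\<bar>)"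
    by (rule infsum_swap_banach)
  then show "(\<Sum>i. \<Sum>k. \<bar>c k i\<bar>) = (\<Sum>k. \<Sum>i. \<bar>c k i\<bar>)"
    using row col' tot tot' by (simp add: inf_eq suminf_nonneg)
qed

lemma l1_const [simp]: "l1 (fps_const c)" and l1_norm_const [simp]: "l1_norm (fps_const c) = \<bar>c\<bar>"
proof -
  have "(\<lambda>n. \<bar>fps_const c $ n\<bar>) sums \<bar>c\<bar>"
    using sums_single[of 0 "\<lambda>_. \<bar>c\<bar>"] by (simp add: fps_const_def if_distrib cong: if_cong)
  then show "l1 (fps_const c)" "l1_norm (fps_const c) = \<bar>c\<bar>"
    by (simp_all add: l1_def l1_norm_def sums_iff)
qed

lemma l1_0 [simp]: "l1 0" and l1_1 [simp]: "l1 1"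
  using l1_const[of 0] l1_const[of 1] by (simp_all del: l1_const)

lemma l1_X [simp]: "l1 fps_X" and l1_norm_X [simp]: "l1_norm fps_X = 1"
proof -
  have "(\<lambda>n. \<bar>fps_X $ n :: real\<bar>) sums 1"
    using sums_single[of 1 "\<lambda>_. 1 :: real"] by (simp add: fps_X_def if_distrib cong: if_cong)
  then show "l1 fps_X" "l1_norm fps_X = 1"
    by (simp_all add: l1_def l1_norm_def sums_iff)
qed

lemma l1_uminus [simp]: "l1 (- f) \<longleftrightarrow> l1 f" and l1_norm_uminus [simp]: "l1_norm (- f) = l1_norm f"
  by (simp_all add: l1_def l1_norm_def)

lemma l1_add: assumes "l1 f" "l1 g" shows "l1 (f + g)"
  unfolding l1_def
  by (rule summable_comparison_test'[OF summable_add[OF assms[unfolded l1_def]]]) simp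

lemma l1_norm_add: assumes "l1 f" "l1 g" shows "l1_norm (f + g) \<le> l1_norm f + l1_norm g"
  unfolding l1_norm_def
  by (subst suminf_add) (use assms l1_add in \<open>auto simp: l1_def intro!: suminf_le summable_add\<close>)

lemma l1_diff: "l1 f \<Longrightarrow> l1 g \<Longrightarrow> l1 (f - g)"
  using l1_add[of f "- g"] by simp

lemma l1_norm_diff: "l1 f \<Longrightarrow> l1 g \<Longrightarrow> l1_norm (f - g) \<le> l1_norm f + l1_norm g"
  using l1_norm_add[of f "- g"] by simp

lemma l1_mult: assumes "l1 f" "l1 g" shows "l1 (f * g)"
  and l1_norm_mult: "l1_norm (f * g) \<le> l1_norm f * l1_norm g"
proof -
  have s: "(\<lambda>k. \<Sum>i\<le>k. \<bar>f $ i\<bar> * \<bar>g $ (k - i)\<bar>) sums (l1_norm f * l1_norm g)"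
    unfolding l1_norm_def
    using Cauchy_product_sums[of "\<lambda>k. \<bar>f $ k\<bar>" "\<lambda>k. \<bar>g $ k\<bar>"] assms by (simp add: l1_def)
  have le: "\<bar>(f * g) $ k\<bar> \<le> (\<Sum>i\<le>k. \<bar>f $ i\<bar> * \<bar>g $ (k - i)\<bar>)" for k
    unfolding fps_mult_nth atLeast0AtMost
    by (rule order_trans[OF sum_abs]) (simp add: abs_mult)
  show l: "l1 (f * g)"
    unfolding l1_def by (rule summable_comparison_test'[OF sums_summable[OF s]]) (use le in simp)
  show "l1_norm (f * g) \<le> l1_norm f * l1_norm g"
    using l le s unfolding l1_norm_def[of "f * g"] l1_def
    using suminf_le[of "\<lambda>k. \<bar>(f * g) $ k\<bar>", OF le] by (simp add: sums_iff)
qed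

lemma l1_sum: "(\<And>i. i \<in> I \<Longrightarrow> l1 (f i)) \<Longrightarrow> l1 (\<Sum>i\<in>I. f i)"
  by (induction I rule: infinite_finite_induct) (auto intro: l1_add)

lemma l1_norm_sum: "(\<And>i. i \<in> I \<Longrightarrow> l1 (f i)) \<Longrightarrow> l1_norm (\<Sum>i\<in>I. f i) \<le> (\<Sum>i\<in>I. l1_norm (f i))"
proof (induction I rule: infinite_finite_induct)
  case (insert x I)
  then show ?case using l1_norm_add[of "f x" "sum f I"] by (force intro: l1_sum)
qed (use l1_norm_const[of 0] in auto)

lemma l1_power: "l1 f \<Longrightarrow> l1 (f ^ k)"
  by (induction k) (auto intro: l1_mult)

lemma l1_norm_power: assumes "l1 f" shows "l1_norm (f ^ k) \<le> l1_norm f ^ k"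
proof (induction k)
  case 0
  then show ?case using l1_norm_const[of 1] by (simp del: l1_norm_const)
next
  case (Suc k)
  have "l1_norm (f ^ Suc k) \<le> l1_norm f * l1_norm (f ^ k)"
    using l1_norm_mult[OF assms l1_power[OF assms]] by simp
  also have "\<dots> \<le> l1_norm f * l1_norm f ^ k"
    by (intro mult_left_mono Suc l1_norm_nonneg assms)
  finally show ?case by simp
qed

lemma l1_prod: "(\<And>i. i \<in> I \<Longrightarrow> l1 (f i)) \<Longrightarrow> l1 (\<Prod>i\<in>I. f i)"
  by (induction I rule: infinite_finite_induct) (auto intro: l1_mult)

lemma l1_norm_prod_le_1:
  assumes "\<And>i. i \<in> I \<Longrightarrow> l1 (f i)" "\<And>i. i \<in> I \<Longrightarrow> l1_norm (f i) \<le> 1"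
  shows "l1_norm (\<Prod>i\<in>I. f i) \<le> 1"
  using assms
proof (induction I rule: infinite_finite_induct)
  case (insert x I)
  have "l1_norm (f x * prod f I) \<le> l1_norm (f x) * l1_norm (prod f I)"
    using insert.prems by (intro l1_norm_mult l1_prod) auto
  also have "\<dots> \<le> 1 * 1"
    using insert by (intro mult_mono l1_norm_nonneg l1_prod) auto
  finally show ?case using insert by simp
qed (use l1_norm_const[of 1] in auto)

lemma l1_nth_le: "l1 f \<Longrightarrow> sum (\<lambda>n. \<bar>f $ n\<bar>) A \<le> l1_norm f" if "finite A"
  unfolding l1_norm_def l1_def by (rule sum_le_suminf) (use that in auto)

lemma l1_norm_nonneg_coeffs:
  assumes "\<And>n. 0 \<le> f $ n" "l1 f" shows "l1_norm f = eval_fps f 1"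
  using assms by (simp add: l1_norm_def eval_fps_def)

lemma l1_normI:
  assumes "\<And>N. (\<Sum>n<N. \<bar>f $ n\<bar>) \<le> C" shows "l1 f" "l1_norm f \<le> C"
proof -
  show "l1 f" unfolding l1_def
    by (rule summableI_nonneg_bounded[where x = C]) (use assms in auto)
  then show "l1_norm f \<le> C" 
    unfolding l1_norm_def l1_def by (intro suminf_le_const assms)
qed

section \<open>Evaluation on [-1, 1]\<close>

lemma abs_power_le_1: "\<bar>z\<bar> \<le> (1::real) \<Longrightarrow> \<bar>z ^ n\<bar> \<le> 1"
  by (simp add: power_abs power_le_one)

lemma abs_mult_power_le:
  assumes "\<bar>z\<bar> \<le> (1::real)" shows "\<bar>c * z ^ n\<bar> \<le> \<bar>c\<bar>"
proof -
  have "\<bar>c\<bar> * \<bar>z ^ n\<bar> \<le> \<bar>c\<bar> * 1"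
    by (intro mult_left_mono abs_power_le_1 assms) simp
  then show ?thesis by (simp only: abs_mult mult_1_right)
qed

lemma l1_summable_abs: assumes "l1 f" "\<bar>z\<bar> \<le> 1" shows "summable (\<lambda>n. \<bar>f $ n * z ^ n\<bar>)"
proof (rule summable_comparison_test'[OF assms(1)[unfolded l1_def]])
  fix n show "norm \<bar>f $ n * z ^ n\<bar> \<le> \<bar>f $ n\<bar>"
    unfolding real_norm_def abs_idempotent by (rule abs_mult_power_le[OF assms(2)])
qed

lemma l1_sums_eval: "l1 f \<Longrightarrow> \<bar>z\<bar> \<le> 1 \<Longrightarrow> (\<lambda>n. f $ n * z ^ n) sums eval_fps f z"
  unfolding eval_fps_def by (rule summable_sums[OF summable_rabs_cancel[OF l1_summable_abs]])

lemma eval_add_l1: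
  assumes "l1 f" "l1 g" "\<bar>z\<bar> \<le> 1" shows "eval_fps (f + g) z = eval_fps f z + eval_fps g z"
proof (rule sums_unique2)
  show "(\<lambda>n. (f + g) $ n * z ^ n) sums eval_fps (f + g) z"
    using assms by (intro l1_sums_eval l1_add)
  show "(\<lambda>n. (f + g) $ n * z ^ n) sums (eval_fps f z + eval_fps g z)"
    using sums_add[OF l1_sums_eval[OF assms(1,3)] l1_sums_eval[OF assms(2,3)]]
    by (simp add: ring_distribs)
qed

lemma eval_uminus_l1:
  assumes "l1 f" "\<bar>z\<bar> \<le> 1" shows "eval_fps (- f) z = - eval_fps f z"
proof (rule sums_unique2)
  show "(\<lambda>n. (- f) $ n * z ^ n) sums eval_fps (- f) z"
    using assms by (intro l1_sums_eval) simp_all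
  show "(\<lambda>n. (- f) $ n * z ^ n) sums (- eval_fps f z)"
    using sums_minus[OF l1_sums_eval[OF assms]] by simp
qed

lemma eval_diff_l1: "l1 f \<Longrightarrow> l1 g \<Longrightarrow> \<bar>z\<bar> \<le> 1 \<Longrightarrow> eval_fps (f - g) z = eval_fps f z - eval_fps g z"
  using eval_add_l1[of f "- g"] by (simp add: eval_uminus_l1)

lemma eval_mult_l1:
  assumes "l1 f" "l1 g" "\<bar>z\<bar> \<le> 1" shows "eval_fps (f * g) z = eval_fps f z * eval_fps g z"
proof -
  have "(\<lambda>k. \<Sum>i\<le>k. (f $ i * z ^ i) * (g $ (k - i) * z ^ (k - i))) sums (eval_fps f z * eval_fps g z)"
    unfolding eval_fps_def
    using Cauchy_product_sums[of "\<lambda>k. f $ k * z ^ k" "\<lambda>k. g $ k * z ^ k"] assms by (simp add: l1_summable_abs)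
  also have "(\<lambda>k. \<Sum>i\<le>k. (f $ i * z ^ i) * (g $ (k - i) * z ^ (k - i))) = (\<lambda>k. (f * g) $ k * z ^ k)"
  proof
    fix k
    have "(f $ i * z ^ i) * (g $ (k - i) * z ^ (k - i)) = f $ i * g $ (k - i) * z ^ k" if "i \<le> k" for i
      using power_add[of z i "k - i"] that by simp
    then show "(\<Sum>i\<le>k. (f $ i * z ^ i) * (g $ (k - i) * z ^ (k - i))) = (f * g) $ k * z ^ k"
      unfolding fps_mult_nth atLeast0AtMost sum_distrib_right by (intro sum.cong) auto
  qed
  finally have "(\<lambda>k. (f * g) $ k * z ^ k) sums (eval_fps f z * eval_fps g z)" .
  moreover have "(\<lambda>k. (f * g) $ k * z ^ k) sums eval_fps (f * g) z"
    using assms by (intro l1_sums_eval l1_mult)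
  ultimately show ?thesis by (rule sums_unique2[symmetric])
qed

lemma eval_power_l1: "l1 f \<Longrightarrow> \<bar>z\<bar> \<le> 1 \<Longrightarrow> eval_fps (f ^ k) z = eval_fps f z ^ k"
  by (induction k) (auto simp: eval_mult_l1 l1_power)

lemma l1_conv_radius: assumes "l1 f" shows "1 \<le> fps_conv_radius f"
  unfolding fps_conv_radius_def
  using conv_radius_geI[of "fps_nth f" 1] l1_sums_eval[OF assms, of 1] by (simp add: sums_iff one_ereal_def)

lemma l1_has_derivative_eval:
  assumes "l1 f" "\<bar>z\<bar> < 1"
  shows "(eval_fps f has_field_derivative eval_fps (fps_deriv f) z) (at z within A)"
proof (rule has_field_derivative_eval_fps)
  have "ereal (norm z) < 1" using assms by (simp add: one_ereal_def)
  then show "ereal (norm z) < fps_conv_radius f" using l1_conv_radius[OF assms(1)] by (rule less_le_trans)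
qed

text \<open>Divide the difference by its leading power of z: the quotient vanishes on (0, 1) and is
  continuous at 0, so its constant term, nonzero by construction, would be 0.\<close>

lemma fps_eqI_conv_radius:
  fixes f g :: "real fps"
  assumes rf: "1 \<le> fps_conv_radius f" and rg: "1 \<le> fps_conv_radius g"
    and eq: "\<And>z. 0 < z \<Longrightarrow> z < 1 \<Longrightarrow> eval_fps f z = eval_fps g z"
  shows "f = g"
proof (rule ccontr)
  have less: "ereal (norm z) < fps_conv_radius F" if "\<bar>z\<bar> < 1" "1 \<le> fps_conv_radius F" for F and z :: real
    using that by (simp add: less_le_trans[of _ "1 :: ereal"] one_ereal_def)
  define h where "h = f - g"
  assume "f \<noteq> g"
  then have h: "h \<noteq> 0" by (simp add: h_def)
  define n where "n = subdegree h"
  define k where "k = fps_shift n h"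
  have dec: "h = k * fps_X ^ n" unfolding k_def n_def by (rule subdegree_decompose)
  have k0: "k $ 0 \<noteq> 0" using h by (simp add: k_def n_def)
  have rh: "1 \<le> fps_conv_radius h" unfolding h_def
    using fps_conv_radius_diff[of f g] rf rg by (meson min.boundedI order_trans)
  have rk: "1 \<le> fps_conv_radius k" using rh by (simp add: k_def)
  have z: "eval_fps k z = 0" if "0 < z" "z < 1" for z
  proof -
    have "eval_fps k z * z ^ n = eval_fps h z"
      unfolding dec using that rk less[of z k] by (subst eval_fps_mult) auto
    also have "\<dots> = 0" unfolding h_def using that rf rg eq[OF that] less[of z f] less[of z g]
      by (subst eval_fps_diff) auto
    finally show ?thesis using that by simp
  qed
  have "isCont (eval_fps k) 0"
    using has_field_derivative_eval_fps[of 0 k UNIV] rk less[of 0 k] by (auto intro: DERIV_isCont)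
  then have "(eval_fps k \<longlongrightarrow> k $ 0) (at_right 0)"
    by (metis eval_fps_at_0 isCont_def tendsto_within_subset top_greatest filterlim_at_split)
  moreover have "\<forall>\<^sub>F z in at_right 0. eval_fps k z = 0"
    using z by (auto simp: eventually_at_right_field intro!: exI[of _ 1])
  then have "(eval_fps k \<longlongrightarrow> 0) (at_right 0)"
    by (rule tendsto_eventually)
  ultimately show False using k0 tendsto_unique[of "at_right (0::real)"] by auto
qed

lemmas fps_eqI_eval = fps_eqI_conv_radius[OF l1_conv_radius l1_conv_radius]

text \<open>Each partial sum of the coefficients is the limit, as z tends to 1 from below, of
  quantities below \<open>b z\<close>; estimates inside the interval thus control the norm.\<close>

lemma l1_nonneg_boundI:
  assumes "l1 f" "\<And>n. 0 \<le> f $ n" and bound: "\<And>z. 0 < z \<Longrightarrow> z < 1 \<Longrightarrow> eval_fps f z \<le> b z"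
    and lim: "(b \<longlongrightarrow> C) (at_left 1)"
  shows "l1_norm f \<le> C"
proof -
  have "(\<Sum>n<N. \<bar>f $ n\<bar>) \<le> C" for N
  proof -
    have "(\<Sum>n<N. f $ n * z ^ n) \<le> b z" if "0 < z" "z < 1" for z
    proof -
      have "(\<Sum>n<N. f $ n * z ^ n) \<le> eval_fps f z"
        using l1_sums_eval[OF assms(1), of z] that assms(2)
        unfolding sums_iff eval_fps_def by (intro sum_le_suminf) auto
      then show ?thesis using bound[OF that] by simp
    qed
    then have "\<forall>\<^sub>F z in at_left 1. (\<Sum>n<N. f $ n * z ^ n) \<le> b z"
      by (auto simp: eventually_at_left_field intro!: exI[of _ 0])
    moreover have "((\<lambda>z. \<Sum>n<N. f $ n * z ^ n) \<longlongrightarrow> (\<Sum>n<N. f $ n * 1 ^ n)) (at_left 1)"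
      by (intro tendsto_intros)
    ultimately have "(\<Sum>n<N. f $ n * 1 ^ n) \<le> C"
      by (intro tendsto_le[OF _ lim]) auto
    then show ?thesis using assms(2) by simp
  qed
  then show ?thesis by (rule l1_normI)
qed

text \<open>The left side is the absolute value of the sum of the coefficients outside
  \<open>A\<close>, the right side the sum of their absolute values.\<close>

lemma l1_complement_le:
  assumes "l1 h" "finite A"
  shows "\<bar>eval_fps h 1 - (\<Sum>n\<in>A. h $ n)\<bar> \<le> l1_norm h - (\<Sum>n\<in>A. \<bar>h $ n\<bar>)"
proof -
  define u where "u n = (if n \<in> A then h $ n else 0)" for n
  have u: "u sums (\<Sum>n\<in>A. h $ n)" unfolding u_def by (rule sums_If_finite_set[OF assms(2)])
  have ua: "(\<lambda>n. \<bar>u n\<bar>) sums (\<Sum>n\<in>A. \<bar>h $ n\<bar>)" unfolding u_def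
    using sums_If_finite_set[OF assms(2), of "\<lambda>n. \<bar>h $ n\<bar>"] by (simp add: if_distrib cong: if_cong)
  have d: "(\<lambda>n. h $ n - u n) sums (eval_fps h 1 - (\<Sum>n\<in>A. h $ n))"
    using sums_diff[OF l1_sums_eval[OF assms(1), of 1] u] by simp
  have da: "(\<lambda>n. \<bar>h $ n - u n\<bar>) sums (l1_norm h - (\<Sum>n\<in>A. \<bar>h $ n\<bar>))"
  proof -
    have "(\<lambda>n. \<bar>h $ n\<bar> - \<bar>u n\<bar>) sums (l1_norm h - (\<Sum>n\<in>A. \<bar>h $ n\<bar>))"
      using sums_diff[OF _ ua] assms(1) by (simp add: l1_norm_def l1_def summable_sums)
    also have "(\<lambda>n. \<bar>h $ n\<bar> - \<bar>u n\<bar>) = (\<lambda>n. \<bar>h $ n - u n\<bar>)" by (auto simp: u_def)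
    finally show ?thesis .
  qed
  show ?thesis
    using summable_rabs[OF sums_summable[OF da]] d da by (simp add: sums_iff)
qed

text \<open>The factor 1 - z makes the coefficients sum to zero, so the sum over \<open>A\<close> is
  minus the sum over the complement, and the smaller of the two absolute masses is at most half of
  the norm.\<close>

lemma sum_one_minus_X_mult_le:
  assumes "l1 k" "finite A"
  shows "\<bar>\<Sum>n\<in>A. ((1 - fps_X) * k) $ n\<bar> \<le> l1_norm ((1 - fps_X) * k) / 2"
proof -
  define h where "h = (1 - fps_X) * k"
  have l1h: "l1 h" unfolding h_def by (intro l1_mult l1_diff assms) auto
  have "eval_fps h 1 = 0" unfolding h_def using assms by (simp add: eval_mult_l1 l1_diff eval_diff_l1)
  then have "\<bar>\<Sum>n\<in>A. h $ n\<bar> \<le> l1_norm h - (\<Sum>n\<in>A. \<bar>h $ n\<bar>)"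
    using l1_complement_le[OF l1h assms(2)] by simp
  moreover have "\<bar>\<Sum>n\<in>A. h $ n\<bar> \<le> (\<Sum>n\<in>A. \<bar>h $ n\<bar>)" by (rule sum_abs)
  ultimately show ?thesis unfolding h_def by linarith
qed

subsection \<open>Substitution, exponential and binomial thinning\<close>

text \<open>Each coefficient is an infinite series because the inner series may have a nonzero
  constant term: 1 - u for \<open>thin_base u\<close>, -m for the exponent of a Poisson law.\<close>

definition l1_comp :: "real fps \<Rightarrow> real fps \<Rightarrow> real fps" where
  "l1_comp f g = Abs_fps (\<lambda>n. \<Sum>k. f $ k * (g ^ k) $ n)"

context
  fixes f g :: "real fps"
  assumes g: "l1 g" and f: "summable (\<lambda>k. \<bar>f $ k\<bar> * l1_norm g ^ k)"
begin

text \<open>Absolute convergence of the double array behind a substitution, with the evaluation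
  point included: z = 1 serves the coefficients, general z the values.\<close>

lemma l1_comp_row:
  assumes "\<bar>z\<bar> \<le> 1"
  shows "summable (\<lambda>n. \<bar>f $ k * (g ^ k) $ n * z ^ n\<bar>)" (is ?A)
    and "(\<Sum>n. \<bar>f $ k * (g ^ k) $ n * z ^ n\<bar>) \<le> \<bar>f $ k\<bar> * l1_norm g ^ k" (is ?B)
    and "summable (\<lambda>k. \<Sum>n. \<bar>f $ k * (g ^ k) $ n * z ^ n\<bar>)" (is ?C)
proof -
  have s: "summable (\<lambda>n. \<bar>f $ k\<bar> * \<bar>(g ^ k) $ n\<bar>)" for k
    using l1_power[OF g, of k] by (intro summable_mult) (simp add: l1_def)
  have le: "\<bar>f $ k * (g ^ k) $ n * z ^ n\<bar> \<le> \<bar>f $ k\<bar> * \<bar>(g ^ k) $ n\<bar>" for k n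
    using abs_mult_power_le[OF assms, of "f $ k * (g ^ k) $ n" n] by (simp only: abs_mult)
  have A: "summable (\<lambda>n. \<bar>f $ k * (g ^ k) $ n * z ^ n\<bar>)" for k
    by (rule summable_comparison_test'[OF s[of k]]) (use le in \<open>simp only: real_norm_def abs_idempotent\<close>)
  have B: "(\<Sum>n. \<bar>f $ k * (g ^ k) $ n * z ^ n\<bar>) \<le> \<bar>f $ k\<bar> * l1_norm g ^ k" for k
  proof -
    have "(\<Sum>n. \<bar>f $ k * (g ^ k) $ n * z ^ n\<bar>) \<le> (\<Sum>n. \<bar>f $ k\<bar> * \<bar>(g ^ k) $ n\<bar>)"
      by (rule suminf_le[OF le A s])
    also have "\<dots> = \<bar>f $ k\<bar> * l1_norm (g ^ k)"
      using l1_power[OF g, of k] unfolding l1_norm_def l1_def by (rule suminf_mult)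
    also have "\<dots> \<le> \<bar>f $ k\<bar> * l1_norm g ^ k"
      by (intro mult_left_mono l1_norm_power g) simp
    finally show ?thesis .
  qed
  show ?A ?B by (rule A, rule B)
  show ?C
  proof (rule summable_comparison_test'[OF f])
    fix k
    have "0 \<le> (\<Sum>n. \<bar>f $ k * (g ^ k) $ n * z ^ n\<bar>)"
      using A by (intro suminf_nonneg) auto
    then show "norm (\<Sum>n. \<bar>f $ k * (g ^ k) $ n * z ^ n\<bar>) \<le> \<bar>f $ k\<bar> * l1_norm g ^ k"
      using B[of k] by simp
  qed
qed

lemma summable_l1_comp: "summable (\<lambda>k. f $ k * (g ^ k) $ n)"
  using summable_swap_real(1)[OF l1_comp_row(1,3), of 1 n] summable_rabs_cancel by simp

lemma l1_l1_comp: "l1 (l1_comp f g)"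
  and l1_norm_l1_comp: "l1_norm (l1_comp f g) \<le> (\<Sum>k. \<bar>f $ k\<bar> * l1_norm g ^ k)"
proof -
  note row = l1_comp_row[of 1, unfolded power_one mult_1_right, simplified]
  note col = summable_swap_real[OF row(1,3)]
  have le: "\<bar>l1_comp f g $ n\<bar> \<le> (\<Sum>k. \<bar>f $ k * (g ^ k) $ n\<bar>)" for n
    unfolding l1_comp_def fps_nth_Abs_fps by (rule summable_rabs[OF col(1)])
  show l: "l1 (l1_comp f g)" unfolding l1_def
    by (rule summable_comparison_test'[OF col(2)]) (use le in simp)
  have "l1_norm (l1_comp f g) \<le> (\<Sum>n. \<Sum>k. \<bar>f $ k * (g ^ k) $ n\<bar>)"
    using l le col(2) unfolding l1_norm_def l1_def by (intro suminf_le)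
  also have "\<dots> = (\<Sum>k. \<Sum>n. \<bar>f $ k * (g ^ k) $ n\<bar>)" by (rule col(4))
  also have "\<dots> \<le> (\<Sum>k. \<bar>f $ k\<bar> * l1_norm g ^ k)"
    by (rule suminf_le[OF row(2) row(3) f])
  finally show "l1_norm (l1_comp f g) \<le> (\<Sum>k. \<bar>f $ k\<bar> * l1_norm g ^ k)" .
qed

lemma eval_l1_comp:
  assumes z: "\<bar>z\<bar> \<le> 1"
  shows "eval_fps (l1_comp f g) z = eval_fps f (eval_fps g z)"
proof -
  have "eval_fps (l1_comp f g) z = (\<Sum>n. \<Sum>k. f $ k * (g ^ k) $ n * z ^ n)"
    unfolding eval_fps_def l1_comp_def fps_nth_Abs_fps
    by (subst suminf_mult2[OF summable_l1_comp]) (rule refl)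
  also have "\<dots> = (\<Sum>k. \<Sum>n. f $ k * (g ^ k) $ n * z ^ n)"
    by (rule summable_swap_real(3)[OF l1_comp_row(1,3)[OF z]])
  also have "\<dots> = (\<Sum>k. f $ k * eval_fps g z ^ k)"
  proof (rule suminf_cong)
    fix k
    have "(\<lambda>n. f $ k * ((g ^ k) $ n * z ^ n)) sums (f $ k * eval_fps (g ^ k) z)"
      by (intro sums_mult l1_sums_eval l1_power g z)
    then show "(\<Sum>n. f $ k * (g ^ k) $ n * z ^ n) = f $ k * eval_fps g z ^ k"
      by (simp add: sums_iff eval_power_l1 g z mult.assoc)
  qed
  finally show ?thesis by (simp add: eval_fps_def)
qed

end

lemma l1_comp_nonneg:
  assumes "\<And>k. 0 \<le> f $ k" "\<And>k. 0 \<le> (g ^ k) $ n" "summable (\<lambda>k. f $ k * (g ^ k) $ n)"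
  shows "0 \<le> l1_comp f g $ n"
  unfolding l1_comp_def fps_nth_Abs_fps using assms by (intro suminf_nonneg) auto

lemma fps_mult_nonneg: "0 \<le> (f * g) $ n"
  if "\<And>n. 0 \<le> f $ n" "\<And>n. 0 \<le> g $ n" for f g :: "real fps"
  unfolding fps_mult_nth using that by (intro sum_nonneg mult_nonneg_nonneg)

lemma fps_power_nonneg: "0 \<le> (f ^ k) $ n" if "\<And>n. 0 \<le> f $ n" for f :: "real fps"
  using that by (induction k arbitrary: n) (auto intro: fps_mult_nonneg)

section \<open>Exponentials of absolutely summable series\<close>

definition fps_expo :: "real fps \<Rightarrow> real fps" where
  "fps_expo r = l1_comp (fps_exp 1) r"

lemma summable_fps_exp: "summable (\<lambda>k. \<bar>fps_exp (1::real) $ k\<bar> * c ^ k)" for c :: real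
  using summable_exp[of c] by (simp add: divide_inverse mult.commute)

lemma eval_fps_exp_1: "eval_fps (fps_exp 1) z = exp z" for z :: real
  using eval_fps_exp[of 1 z] by simp

lemma l1_fps_expo: "l1 r \<Longrightarrow> l1 (fps_expo r)"
  unfolding fps_expo_def by (intro l1_l1_comp summable_fps_exp)

lemma eval_fps_expo: "l1 r \<Longrightarrow> \<bar>z\<bar> \<le> 1 \<Longrightarrow> eval_fps (fps_expo r) z = exp (eval_fps r z)"
  unfolding fps_expo_def by (simp only: eval_l1_comp summable_fps_exp eval_fps_exp_1)

lemma fps_expo_add: assumes "l1 r" "l1 s" shows "fps_expo (r + s) = fps_expo r * fps_expo s"
  using assms
  by (intro fps_eqI_eval l1_mult l1_fps_expo l1_add)
     (simp_all add: eval_mult_l1 l1_fps_expo eval_fps_expo eval_add_l1 l1_add exp_add)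

lemma fps_expo_const: "fps_expo (fps_const c) = fps_const (exp c)"
  by (intro fps_eqI_eval l1_fps_expo) (simp_all add: eval_fps_expo)

lemma fps_expo_uminus: assumes "l1 r" shows "fps_expo r * fps_expo (- r) = 1"
  using fps_expo_add[of r "- r"] fps_expo_const[of 0] assms by simp

text \<open>The constant term may have either sign: it splits off as the positive scalar
  \<open>exp (r $ 0)\<close>, and what remains has nonnegative coefficients, hence so do its
  powers.\<close>

lemma fps_expo_nonneg:
  assumes "l1 r" "\<And>i. 1 \<le> i \<Longrightarrow> 0 \<le> r $ i"
  shows "0 \<le> fps_expo r $ n"
proof -
  define s where "s = r - fps_const (r $ 0)"
  have s: "l1 s" "0 \<le> s $ i" for i
    using assms by (cases i; auto simp: s_def intro!: l1_diff)+
  have "r = fps_const (r $ 0) + s" by (simp add: s_def)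
  then have "fps_expo r = fps_const (exp (r $ 0)) * fps_expo s"
    using fps_expo_add[OF l1_const s(1)] by (metis fps_expo_const)
  moreover have "0 \<le> fps_expo s $ n"
    unfolding fps_expo_def
    by (intro l1_comp_nonneg fps_power_nonneg s summable_l1_comp summable_fps_exp) simp
  ultimately show ?thesis by simp
qed

text \<open>The chain rule for real functions gives equality on (0, 1). The left side enters through
  its radius of convergence alone, since its absolute summability is a consequence and not yet
  known.\<close>

lemma fps_deriv_fps_expo:
  assumes "l1 r" "l1 (fps_deriv r)"
  shows "fps_deriv (fps_expo r) = fps_deriv r * fps_expo r"
proof (rule fps_eqI_conv_radius)
  show "1 \<le> fps_conv_radius (fps_deriv (fps_expo r))"
    using l1_conv_radius[OF l1_fps_expo[OF assms(1)]] fps_conv_radius_deriv by (rule order_trans)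
  show "1 \<le> fps_conv_radius (fps_deriv r * fps_expo r)"
    by (intro l1_conv_radius l1_mult assms l1_fps_expo)
  fix z :: real assume z: "0 < z" "z < 1"
  have "((\<lambda>z. exp (eval_fps r z)) has_field_derivative exp (eval_fps r z) * eval_fps (fps_deriv r) z) (at z)"
    using z assms by (auto intro!: derivative_eq_intros l1_has_derivative_eval)
  moreover have "\<forall>\<^sub>F w in nhds z. w \<in> {0<..<1}"
    using z by (intro eventually_nhds_in_open) auto
  then have "\<forall>\<^sub>F w in nhds z. exp (eval_fps r w) = eval_fps (fps_expo r) w"
    by eventually_elim (use assms in \<open>auto simp: eval_fps_expo\<close>)
  ultimately have "(eval_fps (fps_expo r) has_field_derivative exp (eval_fps r z) * eval_fps (fps_deriv r) z) (at z)"
    using DERIV_cong_ev by fast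
  moreover have "(eval_fps (fps_expo r) has_field_derivative eval_fps (fps_deriv (fps_expo r)) z) (at z)"
    using z assms by (intro l1_has_derivative_eval l1_fps_expo) auto
  ultimately show "eval_fps (fps_deriv (fps_expo r)) z = eval_fps (fps_deriv r * fps_expo r) z"
    using z assms DERIV_unique by (fastforce simp: eval_mult_l1 l1_fps_expo eval_fps_expo)
qed

section \<open>Binomial thinning\<close>

definition thin_base :: "real \<Rightarrow> real fps" where
  "thin_base u = fps_const (1 - u) + fps_const u * fps_X"

text \<open>For u in [0, 1], \<open>thin_base u\<close> is the generating function of a Bernoulli
  variable with parameter u, so a law \<open>f\<close> becomes the law after keeping each unit
  independently with probability u.\<close>

definition thin :: "real \<Rightarrow> real fps \<Rightarrow> real fps" where
  "thin u f = l1_comp f (thin_base u)"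

lemma thin_base_nth: "thin_base u $ n = (if n = 0 then 1 - u else if n = 1 then u else 0)"
  by (auto simp: thin_base_def)

lemma l1_thin_base [simp]: "l1 (thin_base u)"
  unfolding thin_base_def by (intro l1_add l1_mult) auto

lemma eval_thin_base: "\<bar>z\<bar> \<le> 1 \<Longrightarrow> eval_fps (thin_base u) z = 1 - u + u * z"
  unfolding thin_base_def by (subst eval_add_l1) (auto simp: eval_mult_l1 l1_mult)

lemma thin_base_power_nonneg: "0 \<le> u \<Longrightarrow> u \<le> 1 \<Longrightarrow> 0 \<le> (thin_base u ^ k) $ n"
  by (intro fps_power_nonneg) (auto simp: thin_base_nth)

lemma l1_norm_thin_base: "0 \<le> u \<Longrightarrow> u \<le> 1 \<Longrightarrow> l1_norm (thin_base u) = 1"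
  by (subst l1_norm_nonneg_coeffs) (auto simp: thin_base_nth eval_thin_base)

context
  fixes u :: real and f :: "real fps"
  assumes u: "0 \<le> u" "u \<le> 1" and f: "l1 f"
begin

lemma thin_summable: "summable (\<lambda>k. \<bar>f $ k\<bar> * l1_norm (thin_base u) ^ k)"
  using f by (simp add: l1_norm_thin_base u l1_def)

lemma l1_thin: "l1 (thin u f)"
  unfolding thin_def by (intro l1_l1_comp thin_summable) simp

lemma l1_norm_thin: "l1_norm (thin u f) \<le> l1_norm f"
  using l1_norm_l1_comp[OF _ thin_summable]
  unfolding thin_def l1_norm_thin_base[OF u] power_one mult_1_right
  by (simp add: l1_norm_def[of f])

lemma eval_thin: "\<bar>z\<bar> \<le> 1 \<Longrightarrow> eval_fps (thin u f) z = eval_fps f (1 - u + u * z)"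
  unfolding thin_def by (simp add: eval_l1_comp thin_summable eval_thin_base)

lemma summable_thin_nth: "summable (\<lambda>k. f $ k * (thin_base u ^ k) $ n)"
  by (intro summable_l1_comp thin_summable) simp

end

lemma thin_nth: "thin u f $ n = (\<Sum>k. f $ k * (thin_base u ^ k) $ n)"
  by (simp add: thin_def l1_comp_def)

lemma thin_1: "thin 1 f = f"
proof (rule fps_ext)
  fix n
  have "(\<lambda>k. f $ k * (fps_X ^ k) $ n) sums (\<Sum>k\<in>{n}. f $ k)"
    using sums_If_finite_set[of "{n}" "\<lambda>k. f $ k"] by (simp add: fps_X_power_nth if_distrib eq_commute cong: if_cong)
  then show "thin 1 f $ n = f $ n" by (simp add: thin_nth thin_base_def sums_iff)
qed

lemma thin_0: "thin 0 f = fps_const (eval_fps f 1)"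
  by (rule fps_ext) (simp add: thin_nth thin_base_def eval_fps_def)

lemma thin_base_power_deriv:
  "((\<lambda>u. (thin_base u ^ k) $ n) has_field_derivative
     of_nat k * ((fps_X - 1) * thin_base u ^ (k - 1)) $ n) (at u within S)"
proof (induction k arbitrary: n)
  case 0
  then show ?case by simp
next
  case (Suc k)
  have eq: "(thin_base u ^ Suc k) $ n =
      (1 - u) * (thin_base u ^ k) $ n + u * (fps_X * thin_base u ^ k) $ n" for u
    by (simp add: thin_base_def ring_distribs mult.assoc)
  have dX: "((\<lambda>u. (fps_X * thin_base u ^ k) $ n) has_field_derivative
     of_nat k * (fps_X * ((fps_X - 1) * thin_base u ^ (k - 1))) $ n) (at u within S)"
    by (cases n) (use Suc in simp_all)
  have "((\<lambda>u. (thin_base u ^ Suc k) $ n) has_field_derivative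
     - (thin_base u ^ k) $ n + (1 - u) * (of_nat k * ((fps_X - 1) * thin_base u ^ (k - 1)) $ n)
     + ((fps_X * thin_base u ^ k) $ n + u * (of_nat k * (fps_X * ((fps_X - 1) * thin_base u ^ (k - 1))) $ n)))
     (at u within S)" (is "(_ has_field_derivative ?D) _")
    unfolding eq by (auto intro!: derivative_eq_intros Suc dX)
  moreover have "?D = of_nat (Suc k) * ((fps_X - 1) * thin_base u ^ (Suc k - 1)) $ n"
  proof (cases k)
    case (Suc m)
    have "fps_const (1 - u) * ((fps_X - 1) * thin_base u ^ m) + fps_const u * (fps_X * ((fps_X - 1) * thin_base u ^ m))
       = (fps_X - 1) * thin_base u ^ k"
      by (simp add: Suc thin_base_def algebra_simps)
    then have "(1 - u) * ((fps_X - 1) * thin_base u ^ m) $ n + u * (fps_X * ((fps_X - 1) * thin_base u ^ m)) $ n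
       = ((fps_X - 1) * thin_base u ^ k) $ n"
      by (metis fps_add_nth fps_mult_left_const_nth)
    then have "of_nat k * ((1 - u) * ((fps_X - 1) * thin_base u ^ m) $ n + u * (fps_X * ((fps_X - 1) * thin_base u ^ m)) $ n)
       = of_nat k * ((fps_X - 1) * thin_base u ^ k) $ n" by simp
    moreover have "((fps_X - 1) * thin_base u ^ k) $ n = (fps_X * thin_base u ^ k) $ n - (thin_base u ^ k) $ n"
      by (simp add: ring_distribs)
    ultimately show ?thesis by (simp add: Suc algebra_simps)
  qed (simp add: ring_distribs)
  ultimately show ?case by simp
qed

text \<open>Termwise differentiation in u: the k-th derivative term is at most 2 k |f_k| uniformly
  on [0, 1], where 2 bounds the norm of z - 1, and summability of this majorant is the assumption on
  \<open>fps_deriv f\<close>.\<close>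

lemma thin_nth_deriv:
  assumes "l1 f" "l1 (fps_deriv f)" "0 \<le> u" "u \<le> 1"
  shows "((\<lambda>u. thin u f $ n) has_field_derivative ((fps_X - 1) * thin u (fps_deriv f)) $ n)
           (at u within {0..1})"
proof -
  define d where "d k u = f $ k * (of_nat k * ((fps_X - 1) * thin_base u ^ (k - 1)) $ n)" for k u
  define M where "M k = 2 * \<bar>of_nat k * f $ k\<bar>" for k
  have "summable (\<lambda>k. \<bar>of_nat (Suc k) * f $ (Suc k)\<bar>)"
    using assms(2) by (simp add: l1_def)
  then have "summable (\<lambda>k. \<bar>of_nat k * f $ k\<bar>)"
    by (subst (asm) summable_Suc_iff)
  then have M: "summable M" unfolding M_def by (rule summable_mult)
  have X1: "l1_norm (fps_X - 1) \<le> 2"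
    using l1_norm_diff[of fps_X 1] l1_norm_const[of 1] by (simp del: l1_norm_const)
  have dM: "norm (d k v) \<le> M k" if "v \<in> {0..1}" for k v
  proof -
    have l: "l1 ((fps_X - 1) * thin_base v ^ (k - 1))" by (intro l1_mult l1_diff l1_power) auto
    have "\<bar>((fps_X - 1) * thin_base v ^ (k - 1)) $ n\<bar> \<le> l1_norm ((fps_X - 1) * thin_base v ^ (k - 1))"
      using l1_nth_le[OF _ l, of "{n}"] by simp
    also have "\<dots> \<le> l1_norm (fps_X - 1) * l1_norm (thin_base v ^ (k - 1))"
      by (intro l1_norm_mult l1_diff l1_power) auto
    also have "\<dots> \<le> 2 * 1"
      using l1_norm_power[of "thin_base v" "k - 1"] that
      by (intro mult_mono X1) (auto simp: l1_norm_thin_base intro!: l1_norm_nonneg l1_power)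
    finally have "\<bar>of_nat k * f $ k\<bar> * \<bar>((fps_X - 1) * thin_base v ^ (k - 1)) $ n\<bar> \<le> \<bar>of_nat k * f $ k\<bar> * (2 * 1)"
      by (rule mult_left_mono) simp
    then show ?thesis
      unfolding d_def M_def by (simp only: abs_mult mult_ac real_norm_def mult_1_right)
  qed
  have "uniform_limit {0..1} (\<lambda>N v. \<Sum>k<N. d k v) (\<lambda>v. \<Sum>k. d k v) sequentially"
    using dM M by (intro Weierstrass_m_test) auto
  moreover have "((\<lambda>v. f $ k * (thin_base v ^ k) $ n) has_field_derivative d k v) (at v within {0..1})" for k v
    unfolding d_def by (intro DERIV_cmult thin_base_power_deriv)
  moreover have "summable (\<lambda>k. f $ k * (thin_base 1 ^ k) $ n)"
    by (intro summable_thin_nth) (use assms in auto)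
  ultimately have "\<exists>g. \<forall>v\<in>{0..1}. (\<lambda>k. f $ k * (thin_base v ^ k) $ n) sums g v \<and>
      (g has_field_derivative (\<Sum>k. d k v)) (at v within {0..1})"
    by (intro has_field_derivative_series) auto
  then obtain g where g: "\<And>v. v \<in> {0..1} \<Longrightarrow> (\<lambda>k. f $ k * (thin_base v ^ k) $ n) sums g v"
    "\<And>v. v \<in> {0..1} \<Longrightarrow> (g has_field_derivative (\<Sum>k. d k v)) (at v within {0..1})"
    by blast
  have "(\<Sum>k. d k u) = ((fps_X - 1) * thin u (fps_deriv f)) $ n"
  proof -
    let ?t = "\<lambda>k m. of_nat (Suc k) * f $ Suc k * (thin_base u ^ k) $ m"
    have sm: "?t k m = fps_deriv f $ k * (thin_base u ^ k) $ m" for k m by simp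
    have sm: "(\<lambda>k. ?t k m) sums (thin u (fps_deriv f) $ m)" for m
      unfolding thin_nth sm by (intro summable_sums summable_thin_nth assms)
    have smX: "(\<lambda>k. of_nat (Suc k) * f $ Suc k * (fps_X * thin_base u ^ k) $ n) sums ((fps_X * thin u (fps_deriv f)) $ n)"
      using sm by (cases n) auto
    have "(\<lambda>k. d (Suc k) u) sums (((fps_X - 1) * thin u (fps_deriv f)) $ n)"
      using sums_diff[OF smX sm[of n]] by (simp add: d_def algebra_simps)
    moreover have "d 0 u = 0" by (simp add: d_def)
    ultimately have "(\<lambda>k. d k u) sums (((fps_X - 1) * thin u (fps_deriv f)) $ n)"
      using sums_Suc[of "\<lambda>k. d k u"] by simp
    then show ?thesis by (simp add: sums_iff)
  qed
  with g(2)[of u] assms have "(g has_field_derivative ((fps_X - 1) * thin u (fps_deriv f)) $ n) (at u within {0..1})"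
    by simp
  moreover have "g v = thin v f $ n" if "v \<in> {0..1}" for v
    using g(1)[OF that] by (simp add: thin_nth sums_iff)
  ultimately show ?thesis
    using assms has_field_derivative_transform_within[of g _ u "{0..1}" 1 "\<lambda>u. thin u f $ n"] by auto
qed

subsection \<open>Stein factor in the monotone case\<close>

definition poisson_fps :: "real \<Rightarrow> real fps" where
  "poisson_fps m = fps_expo (fps_const m * (fps_X - 1))"

lemma l1_poisson_exponent [simp]: "l1 (fps_const m * (fps_X - 1))"
  by (intro l1_mult l1_diff) auto

lemma l1_poisson_fps [simp]: "l1 (poisson_fps m)"
  unfolding poisson_fps_def by (intro l1_fps_expo) simp

lemma eval_poisson_fps: "\<bar>z\<bar> \<le> 1 \<Longrightarrow> eval_fps (poisson_fps m) z = exp (m * (z - 1))"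
  unfolding poisson_fps_def by (simp add: eval_fps_expo eval_mult_l1 l1_diff eval_diff_l1)

lemma l1_fps_exp: "l1 (fps_exp m)"
proof -
  have "summable (\<lambda>n. inverse (fact n) * \<bar>m\<bar> ^ n)" by (rule summable_exp)
  then show ?thesis unfolding l1_def by (simp add: power_abs divide_inverse mult.commute abs_mult)
qed

lemma poisson_fps_eq: "poisson_fps m = fps_const (exp (- m)) * fps_exp m"
  by (intro fps_eqI_eval l1_mult l1_fps_exp)
     (simp_all add: eval_poisson_fps eval_mult_l1 l1_fps_exp exp_add[symmetric] algebra_simps)

lemma l1_norm_poisson_fps:
  assumes "0 \<le> m" shows "l1_norm (poisson_fps m) = 1"
proof -
  have "0 \<le> poisson_fps m $ n" for n using assms by (simp add: poisson_fps_eq)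
  then show ?thesis using l1_norm_nonneg_coeffs[of "poisson_fps m"] by (simp add: eval_poisson_fps)
qed

text \<open>Twice the total variation distance of the Poisson law and its shift by one, which is
  \<open>E\<bar>1 - N / m\<bar>\<close>; bounded through the variance of \<open>N\<close>.\<close>

lemma l1_norm_poisson_shift:
  assumes m: "0 < m" shows "l1_norm ((1 - fps_X) * poisson_fps m) \<le> 1 / sqrt m"
proof -
  define e where "e k = m ^ k / fact k" for k
  define s where "s = sqrt m"
  have s: "0 < s" "s * s = m" using m by (auto simp: s_def)
  have e: "e sums exp m"
    using exp_converges[of m] unfolding e_def by (simp add: divide_inverse mult.commute)
  have eS: "real (Suc k) * e (Suc k) = m * e k" for k
    by (simp add: e_def field_simps del: of_nat_Suc)
  have ke: "(\<lambda>k. real k * e k) sums (m * exp m)"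
  proof -
    have "(\<lambda>k. real (Suc k) * e (Suc k)) sums (m * exp m)"
      using sums_mult[OF e, of m] by (simp only: eS)
    then show ?thesis by (subst (asm) sums_Suc_iff) simp
  qed
  have k2e: "(\<lambda>k. real k * real k * e k) sums (m * (m * exp m + exp m))"
  proof -
    have "real (Suc k) * real (Suc k) * e (Suc k) = m * (real k * e k + e k)" for k
      unfolding mult.assoc eS by (simp add: algebra_simps)
    then have "(\<lambda>k. real (Suc k) * real (Suc k) * e (Suc k)) sums (m * (m * exp m + exp m))"
      using sums_mult[OF sums_add[OF ke e], of m] by simp
    then show ?thesis by (subst (asm) sums_Suc_iff) simp
  qed
  \<comment> \<open>For N Poisson with mean m the second moment of 1 - N / m is 1 / m. With s = sqrt
    m the weights s / 2 and 1 / (2 s) make both contributions equal to 1 / (2 s), up to the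
    normalising factor exp m.\<close>
  have up: "(\<lambda>k. s / 2 * (e k - 2 / m * (real k * e k) + 1 / m\<^sup>2 * (real k * real k * e k)) + 1 / (2 * s) * e k)
     sums (s / 2 * (exp m - 2 / m * (m * exp m) + 1 / m\<^sup>2 * (m * (m * exp m + exp m))) + 1 / (2 * s) * exp m)"
    by (intro sums_add sums_mult sums_diff e ke k2e)
  also have "s / 2 * (exp m - 2 / m * (m * exp m) + 1 / m\<^sup>2 * (m * (m * exp m + exp m))) + 1 / (2 * s) * exp m = exp m / s"
    unfolding s(2)[symmetric] using s(1) by (simp add: field_simps power2_eq_square)
  also have "(\<lambda>k. s / 2 * (e k - 2 / m * (real k * e k) + 1 / m\<^sup>2 * (real k * real k * e k)) + 1 / (2 * s) * e k)
    = (\<lambda>k. e k * (s / 2 * (1 - real k / m)\<^sup>2 + 1 / (2 * s)))"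
    using m by (auto simp: field_simps power2_eq_square)
  finally have up: "(\<lambda>k. e k * (s / 2 * (1 - real k / m)\<^sup>2 + 1 / (2 * s))) sums (exp m / s)" .
  have amgm: "\<bar>a\<bar> \<le> s / 2 * a\<^sup>2 + 1 / (2 * s)" for a
  proof -
    have "(s * b - 1)\<^sup>2 / (2 * s) = s / 2 * b\<^sup>2 - b + 1 / (2 * s)" for b
      using s(1) by (simp add: field_simps power2_eq_square)
    moreover have "0 \<le> (s * \<bar>a\<bar> - 1)\<^sup>2 / (2 * s)" using s(1) by simp
    ultimately have "0 \<le> s / 2 * \<bar>a\<bar>\<^sup>2 - \<bar>a\<bar> + 1 / (2 * s)" by simp
    then show ?thesis by simp
  qed
  \<comment> \<open>Multiplication by 1 - z takes backward differences, and e_(k-1) = (k / m) e_k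
    turns these into the factor 1 - k / m.\<close>
  have nth: "((1 - fps_X) * fps_exp m) $ k = e k * (1 - real k / m)" for k
  proof (cases k)
    case (Suc j)
    have "((1 - fps_X) * fps_exp m) $ k = e k - e j"
      unfolding Suc by (simp add: e_def ring_distribs)
    also have "\<dots> = e k - real k * e k / m"
      unfolding Suc eS using m by simp
    finally show ?thesis by (simp add: algebra_simps)
  qed (simp add: e_def)
  have "\<bar>((1 - fps_X) * fps_exp m) $ k\<bar> \<le> e k * (s / 2 * (1 - real k / m)\<^sup>2 + 1 / (2 * s))" for k
  proof -
    have e0: "0 \<le> e k" using m by (simp add: e_def)
    show ?thesis
      unfolding nth abs_mult abs_of_nonneg[OF e0] by (rule mult_left_mono[OF amgm e0])
  qed
  then have le: "l1_norm ((1 - fps_X) * fps_exp m) \<le> exp m / s"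
    unfolding l1_norm_def sums_unique[OF up]
    using l1_mult[OF l1_diff[OF l1_1 l1_X] l1_fps_exp[of m]] sums_summable[OF up]
    by (intro suminf_le) (auto simp only: l1_def)
  have "l1_norm ((1 - fps_X) * poisson_fps m) = l1_norm (fps_const (exp (- m)) * ((1 - fps_X) * fps_exp m))"
    by (simp only: poisson_fps_eq mult_ac)
  also have "\<dots> \<le> exp (- m) * l1_norm ((1 - fps_X) * fps_exp m)"
    using l1_norm_mult[of "fps_const (exp (- m))" "(1 - fps_X) * fps_exp m"]
    by (simp add: l1_mult l1_diff l1_fps_exp)
  also have "\<dots> \<le> exp (- m) * (exp m / s)" by (intro mult_left_mono le) simp
  also have "\<dots> = 1 / sqrt m" by (simp add: s_def exp_minus)
  finally show ?thesis .
qed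

text \<open>For fixed n the weights u P(Bin(k, u) = n) sum over k to at most 1, and only k \<ge> n
  contribute, where the sequence is at most its value at n. At n = 0 the term k = 0 has weight u,
  and the rest has weight at most 1 - u on values not exceeding \<open>\<sigma> $ 1\<close>; this is
  the source of the gain.\<close>

lemma thin_decseq_le:
  fixes \<sigma> :: "real fps"
  assumes l: "l1 \<sigma>" and nonneg: "\<And>k. 0 \<le> \<sigma> $ k" and dec: "\<And>k. \<sigma> $ Suc k \<le> \<sigma> $ k"
    and u: "0 \<le> u" "u \<le> 1"
  shows "u * thin u \<sigma> $ n \<le> \<sigma> $ n" and "u * thin u \<sigma> $ 0 \<le> \<sigma> $ 0 - (\<sigma> $ 0 - \<sigma> $ 1) * (1 - u)"
proof -
  have mono: "\<sigma> $ j \<le> \<sigma> $ i" if "i \<le> j" for i j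
    using lift_Suc_antimono_le[of "fps_nth \<sigma>"] dec that by blast
  \<comment> \<open>Telescoping: 1 - \<open>thin_base u\<close> is u (1 - z), so multiplying by 1 -
    z turns the geometric sum into 1 - \<open>thin_base u ^ N\<close>, whose coefficients are at
    most 1 at index 0 and at most 0 elsewhere; partial summation undoes the factor.\<close>
  have geo: "u * (\<Sum>k<N. (thin_base u ^ k) $ n) \<le> 1" for N n
  proof -
    have "1 - thin_base u = fps_const u * (1 - fps_X)"
      by (rule fps_ext) (simp add: thin_base_nth)
    moreover have "(1 - thin_base u) * (\<Sum>k<N. thin_base u ^ k) = 1 - thin_base u ^ N"
      by (rule one_diff_power_eq[symmetric])
    ultimately have eq: "(1 - fps_X) * (fps_const u * (\<Sum>k<N. thin_base u ^ k)) = 1 - thin_base u ^ N"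
      by (simp add: mult_ac)
    define G where "G = fps_const u * (\<Sum>k<N. thin_base u ^ k)"
    have "G $ n = (\<Sum>i\<le>n. ((1 - fps_X) * G) $ i)"
      by (induction n) (simp_all add: ring_distribs)
    also have "(\<Sum>i\<le>n. ((1 - fps_X) * G) $ i) \<le> (\<Sum>i\<le>n. if i = 0 then 1 else 0)"
      unfolding eq[folded G_def] by (intro sum_mono) (use thin_base_power_nonneg[OF u] in auto)
    also have "(\<Sum>i\<le>n. if i = 0 then 1 else 0) = (1::real)" by (simp add: sum.If_cases)
    finally show ?thesis by (simp add: G_def fps_sum_nth)
  qed
  have sm: "(\<lambda>k. u * (\<sigma> $ k * (thin_base u ^ k) $ n)) sums (u * thin u \<sigma> $ n)" for n
    unfolding thin_nth by (intro sums_mult summable_sums summable_thin_nth u l)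
  have low: "(thin_base u ^ k) $ n = 0" if "k < n" for k n
    using that
  proof (induction k arbitrary: n)
    case (Suc k)
    then show ?case
      by (cases n) (auto simp: thin_base_def ring_distribs mult.assoc)
  qed auto
  have partial: "(\<Sum>k<N. u * (\<sigma> $ k * (thin_base u ^ k) $ n)) \<le> \<sigma> $ n" for N n
  proof -
    have "(\<Sum>k<N. u * (\<sigma> $ k * (thin_base u ^ k) $ n)) \<le> (\<Sum>k<N. \<sigma> $ n * (u * (thin_base u ^ k) $ n))"
    proof (rule sum_mono)
      fix k
      show "u * (\<sigma> $ k * (thin_base u ^ k) $ n) \<le> \<sigma> $ n * (u * (thin_base u ^ k) $ n)"
      proof (cases "k < n")
        case False
        then have "\<sigma> $ k * (u * (thin_base u ^ k) $ n) \<le> \<sigma> $ n * (u * (thin_base u ^ k) $ n)"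
          using mono[of n k] thin_base_power_nonneg[OF u] u by (intro mult_right_mono) auto
        then show ?thesis by (simp add: mult_ac)
      qed (simp add: low)
    qed
    also have "\<dots> = \<sigma> $ n * (u * (\<Sum>k<N. (thin_base u ^ k) $ n))"
      by (simp add: sum_distrib_left)
    also have "\<dots> \<le> \<sigma> $ n * 1" by (intro mult_left_mono geo nonneg)
    finally show ?thesis by simp
  qed
  show "u * thin u \<sigma> $ n \<le> \<sigma> $ n"
    unfolding sums_unique[OF sm] by (rule suminf_le_const[OF sums_summable[OF sm] partial])
  have p0: "(thin_base u ^ k) $ 0 = (1 - u) ^ k" for k
    by (simp add: fps_power_zeroth thin_base_nth)
  have "(\<Sum>k<N. u * (\<sigma> $ k * (thin_base u ^ k) $ 0)) \<le> \<sigma> $ 0 - (\<sigma> $ 0 - \<sigma> $ 1) * (1 - u)" for N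
  proof (cases N)
    case 0
    have "(\<sigma> $ 0 - \<sigma> $ 1) * (1 - u) \<le> (\<sigma> $ 0 - \<sigma> $ 1) * 1"
      using mono[of 0 1] u by (intro mult_left_mono) auto
    then show ?thesis using nonneg[of 1] nonneg[of 0] by (simp add: 0)
  next
    case (Suc N')
    have "(\<Sum>k<N. u * (\<sigma> $ k * (thin_base u ^ k) $ 0))
        = u * \<sigma> $ 0 + (\<Sum>k<N'. u * (\<sigma> $ Suc k * (1 - u) ^ Suc k))"
      unfolding p0 Suc by (subst sum.lessThan_Suc_shift) simp
    also have "(\<Sum>k<N'. u * (\<sigma> $ Suc k * (1 - u) ^ Suc k)) \<le> (\<Sum>k<N'. (\<sigma> $ 1 * (1 - u)) * (u * (1 - u) ^ k))"
    proof (rule sum_mono)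
      fix k
      have "\<sigma> $ Suc k * (u * (1 - u) ^ Suc k) \<le> \<sigma> $ 1 * (u * (1 - u) ^ Suc k)"
        using mono[of 1 "Suc k"] u by (intro mult_right_mono) auto
      then show "u * (\<sigma> $ Suc k * (1 - u) ^ Suc k) \<le> (\<sigma> $ 1 * (1 - u)) * (u * (1 - u) ^ k)"
        by (simp add: mult_ac)
    qed
    also have "\<dots> = (\<sigma> $ 1 * (1 - u)) * (u * (\<Sum>k<N'. (thin_base u ^ k) $ 0))"
      by (simp add: sum_distrib_left p0)
    also have "\<dots> \<le> (\<sigma> $ 1 * (1 - u)) * 1"
      using u nonneg[of 1] by (intro mult_left_mono geo) auto
    finally show ?thesis by (simp add: algebra_simps)
  qed
  then show "u * thin u \<sigma> $ 0 \<le> \<sigma> $ 0 - (\<sigma> $ 0 - \<sigma> $ 1) * (1 - u)"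
    unfolding sums_unique[OF sm] by (rule suminf_le_const[OF sums_summable[OF sm]])
qed

text \<open>Chain rule for w = 1 - u + u z. The case u = 0 is separate because w is then the
  boundary point 1, outside the open interval on which evaluations are differentiated.\<close>

lemma fps_deriv_thin:
  assumes "l1 f" "l1 (fps_deriv f)" "0 \<le> u" "u \<le> 1"
  shows "fps_deriv (thin u f) = fps_const u * thin u (fps_deriv f)"
proof (cases "u = 0")
  case True
  then show ?thesis by (simp add: thin_0)
next
  case False
  show ?thesis
  proof (rule fps_eqI_conv_radius)
    show "1 \<le> fps_conv_radius (fps_deriv (thin u f))"
      using l1_conv_radius[OF l1_thin[OF assms(3,4,1)]] fps_conv_radius_deriv by (rule order_trans)
    show "1 \<le> fps_conv_radius (fps_const u * thin u (fps_deriv f))"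
      by (intro l1_conv_radius l1_mult l1_thin assms) simp
    fix z :: real assume z: "0 < z" "z < 1"
    have w: "\<bar>1 - u + u * z\<bar> < 1"
      using z assms False mult_strict_left_mono[of z 1 u] mult_nonneg_nonneg[of u z] by simp
    have "((\<lambda>z. 1 - u + u * z) has_field_derivative u) (at z)"
      by (auto intro!: derivative_eq_intros)
    then have "((\<lambda>z. eval_fps f (1 - u + u * z)) has_field_derivative eval_fps (fps_deriv f) (1 - u + u * z) * u) (at z)"
      by (rule DERIV_chain2[where f = "eval_fps f" and g = "\<lambda>z. 1 - u + u * z",
            OF l1_has_derivative_eval[OF assms(1) w]])
    moreover have "\<forall>\<^sub>F w in nhds z. w \<in> {0<..<1}"
      using z by (intro eventually_nhds_in_open) auto
    then have "\<forall>\<^sub>F w in nhds z. eval_fps f (1 - u + u * w) = eval_fps (thin u f) w"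
      by eventually_elim (use assms in \<open>auto simp: eval_thin\<close>)
    ultimately have "(eval_fps (thin u f) has_field_derivative eval_fps (fps_deriv f) (1 - u + u * z) * u) (at z)"
      using DERIV_cong_ev by fast
    moreover have "(eval_fps (thin u f) has_field_derivative eval_fps (fps_deriv (thin u f)) z) (at z)"
      using z assms by (intro l1_has_derivative_eval l1_thin) auto
    ultimately have "eval_fps (fps_deriv (thin u f)) z = eval_fps (fps_deriv f) (1 - u + u * z) * u"
      using DERIV_unique by blast
    then show "eval_fps (fps_deriv (thin u f)) z = eval_fps (fps_const u * thin u (fps_deriv f)) z"
      using z assms by (simp add: eval_mult_l1 l1_thin eval_thin)
  qed
qed

text \<open>The k-th coefficient of \<open>fps_deriv L\<close> is (k + 1) times
  \<open>L $ (k + 1)\<close>, so \<open>dec\<close> says that j \<open>L $ j\<close> is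
  non-increasing from j = 1 on: the condition selecting the monotone branch of the Stein
  factor.\<close>

locale monotone_rates =
  fixes L :: "real fps"
  assumes L: "l1 L" and L': "l1 (fps_deriv L)"
    and L_nonneg: "\<And>k. 0 \<le> L $ k"
    and dec: "\<And>k. fps_deriv L $ Suc k \<le> fps_deriv L $ k"
begin

definition \<theta> :: real where "\<theta> = fps_deriv L $ 0 - fps_deriv L $ 1"

lemma \<theta>_nonneg: "0 \<le> \<theta>" using dec[of 0] by (simp add: \<theta>_def)

text \<open>\<open>fps_expo (L - thin u L)\<close> is the law of the immigration part, over the time \<open>- ln u\<close>, of the immigration-death process with unit
  per-capita death rate whose stationary law is the compound Poisson law with
  weights \<open>L\<close>. Batches of size one immigrate at rate \<open>\<theta>\<close>, which splits off a Poisson factor.\<close>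

lemma immigration_factor:
  assumes u: "0 \<le> u" "u \<le> 1"
  obtains G where "l1 G" "l1_norm G \<le> 1"
    "fps_expo (L - thin u L) = poisson_fps (\<theta> * (1 - u)) * G"
proof -
  define m where "m = \<theta> * (1 - u)"
  define r where "r = L - thin u L - fps_const m * (fps_X - 1)"
  have m: "0 \<le> m" using u \<theta>_nonneg by (simp add: m_def)
  have lt: "l1 (thin u L)" by (intro l1_thin u L)
  have lr: "l1 r" unfolding r_def by (intro l1_diff L lt) simp
  have L'_nonneg: "0 \<le> fps_deriv L $ k" for k using L_nonneg[of "Suc k"] by simp
  \<comment> \<open>Multiplying by i + 1 passes to coefficients of the derivative, where thinning of
    a non-increasing sequence is controlled. Removing the Poisson exponent lowers the coefficient of
    z by m, which is exactly the gain at index 0 of the derivative.\<close>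
  have coeff: "0 \<le> r $ Suc i" for i
  proof -
    have "real (Suc i) * thin u L $ Suc i = u * thin u (fps_deriv L) $ i"
      using arg_cong[OF fps_deriv_thin[OF L L' u], of "\<lambda>f. f $ i"] by simp
    moreover have "real (Suc i) * L $ Suc i = fps_deriv L $ i" by simp
    moreover have "u * thin u (fps_deriv L) $ i \<le> fps_deriv L $ i - (if i = 0 then m else 0)"
      using thin_decseq_le(1)[OF L' L'_nonneg dec u, of i] thin_decseq_le(2)[OF L' L'_nonneg dec u]
      unfolding m_def \<theta>_def by (cases "i = 0") (simp_all only: if_True if_False diff_zero refl)
    ultimately have "0 \<le> real (Suc i) * (L $ Suc i - thin u L $ Suc i) - (if i = 0 then m else 0)"
      by (simp add: ring_distribs)
    also have "\<dots> = real (Suc i) * r $ Suc i"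
      by (auto simp: r_def fps_X_def)
    finally show ?thesis by (simp add: zero_le_mult_iff del: of_nat_Suc)
  qed
  then have coeff: "0 \<le> r $ i" if "1 \<le> i" for i
    using that by (cases i) auto
  have "fps_expo (L - thin u L) = fps_expo (fps_const m * (fps_X - 1) + r)"
    by (simp add: r_def)
  also have "\<dots> = poisson_fps m * fps_expo r"
    unfolding poisson_fps_def by (intro fps_expo_add lr) simp
  finally have eq: "fps_expo (L - thin u L) = poisson_fps m * fps_expo r" .
  have "l1_norm (fps_expo r) \<le> 1"
  proof (rule l1_nonneg_boundI)
    show "l1 (fps_expo r)" by (intro l1_fps_expo lr)
    show "0 \<le> fps_expo r $ n" for n by (intro fps_expo_nonneg lr coeff)
    fix z :: real assume z: "0 < z" "z < 1"
    define w where "w = 1 - u + u * z"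
    \<comment> \<open>Thinning moves the argument towards 1 and \<open>L\<close> is non-decreasing
      on [0, 1], so only the removed Poisson exponent can make \<open>r\<close> positive, and its
      contribution vanishes as z tends to 1.\<close>
    have w: "z \<le> w" "w \<le> 1"
      using u z mult_nonneg_nonneg[of "1 - u" "1 - z"] mult_left_mono[of z 1 u] by (auto simp: w_def algebra_simps)
    have "eval_fps L z \<le> eval_fps L w"
    proof (rule sums_le)
      show "L $ n * z ^ n \<le> L $ n * w ^ n" for n
        using z w by (intro mult_left_mono power_mono L_nonneg) auto
    qed (use z w in \<open>auto intro!: l1_sums_eval L\<close>)
    moreover have "eval_fps r z = eval_fps L z - eval_fps L w - m * (z - 1)"
      using z u L lt unfolding r_def w_def
      by (simp add: eval_diff_l1 l1_diff eval_mult_l1 eval_thin)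
    ultimately have "eval_fps r z \<le> m * (1 - z)"
      by (simp add: algebra_simps)
    then show "eval_fps (fps_expo r) z \<le> exp (m * (1 - z))"
      using z lr by (simp add: eval_fps_expo)
  next
    have "((\<lambda>z. exp (m * (1 - z))) \<longlongrightarrow> exp (m * (1 - 1))) (at_left (1::real))"
      by (intro tendsto_intros)
    then show "((\<lambda>z. exp (m * (1 - z))) \<longlongrightarrow> 1) (at_left (1::real))" by simp
  qed
  with eq l1_fps_expo[OF lr] show thesis unfolding m_def by (intro that)
qed

text \<open>Half the norm of (1 - z) times the Poisson factor is at most 1, as 1 - z has norm at
  most 2, and at most 1 / (2 sqrt m) by the shift estimate; \<open>G\<close> is a contraction. The
  first bound also covers \<open>\<theta>\<close> = 0.\<close>

lemma immigration_smooth: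
  assumes u: "0 \<le> u" "u \<le> 1" and T: "l1 T" and A: "finite A"
  shows "\<bar>\<Sum>y\<in>A. ((1 - fps_X) * (fps_expo (L - thin u L) * T)) $ y\<bar> \<le> l1_norm T"
    and "\<theta> * (1 - u) > 0 \<Longrightarrow>
      \<bar>\<Sum>y\<in>A. ((1 - fps_X) * (fps_expo (L - thin u L) * T)) $ y\<bar> \<le> l1_norm T / (2 * sqrt (\<theta> * (1 - u)))"
proof -
  define m where "m = \<theta> * (1 - u)"
  have m: "0 \<le> m" using u \<theta>_nonneg by (simp add: m_def)
  obtain G where G: "l1 G" "l1_norm G \<le> 1" "fps_expo (L - thin u L) = poisson_fps m * G"
    using immigration_factor[OF u] unfolding m_def by blast
  let ?S = "(1 - fps_X) * poisson_fps m"
  have lS: "l1 ?S" by (intro l1_mult l1_diff) auto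
  have eq: "(1 - fps_X) * (fps_expo (L - thin u L) * T) = ?S * (G * T)"
    unfolding G by (simp only: mult.assoc)
  have "\<bar>\<Sum>y\<in>A. ((1 - fps_X) * (fps_expo (L - thin u L) * T)) $ y\<bar> \<le> l1_norm (?S * (G * T)) / 2"
    unfolding eq[symmetric] G by (intro sum_one_minus_X_mult_le l1_mult A G T) simp
  also have "l1_norm (?S * (G * T)) \<le> l1_norm ?S * l1_norm T"
  proof -
    have "l1_norm (?S * (G * T)) \<le> l1_norm ?S * l1_norm (G * T)"
      by (intro l1_norm_mult lS l1_mult G T)
    also have "l1_norm (G * T) \<le> l1_norm G * l1_norm T" by (rule l1_norm_mult[OF G(1) T])
    also have "\<dots> \<le> 1 * l1_norm T" by (rule mult_right_mono[OF G(2) l1_norm_nonneg[OF T]])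
    finally show ?thesis using l1_norm_nonneg[OF lS] by (simp add: mult_left_mono)
  qed
  finally have le: "\<bar>\<Sum>y\<in>A. ((1 - fps_X) * (fps_expo (L - thin u L) * T)) $ y\<bar> \<le> l1_norm ?S * l1_norm T / 2"
    by simp
  have "l1_norm (1 - fps_X) \<le> 2"
    using l1_norm_diff[of 1 fps_X] l1_norm_const[of 1] by (simp del: l1_norm_const)
  then have "l1_norm ?S \<le> 2"
    using l1_norm_mult[of "1 - fps_X" "poisson_fps m"] m by (simp add: l1_norm_poisson_fps l1_diff)
  then have "l1_norm ?S * l1_norm T \<le> 2 * l1_norm T"
    by (intro mult_right_mono l1_norm_nonneg T)
  with le show "\<bar>\<Sum>y\<in>A. ((1 - fps_X) * (fps_expo (L - thin u L) * T)) $ y\<bar> \<le> l1_norm T" by simp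
  assume "\<theta> * (1 - u) > 0"
  then have "l1_norm ?S \<le> 1 / sqrt m" unfolding m_def by (rule l1_norm_poisson_shift)
  then have "l1_norm ?S * l1_norm T \<le> 1 / sqrt m * l1_norm T"
    by (intro mult_right_mono l1_norm_nonneg T)
  with le show "\<bar>\<Sum>y\<in>A. ((1 - fps_X) * (fps_expo (L - thin u L) * T)) $ y\<bar> \<le> l1_norm T / (2 * sqrt (\<theta> * (1 - u)))"
    by (simp add: m_def)
qed

text \<open>\<open>flow A u\<close> interpolates between \<open>P(A)\<close> at \<open>u = 1\<close> and the compound Poisson measure of \<open>A\<close>
  at \<open>u = 0\<close>: the generating function of the law at \<open>u\<close> is
  \<open>P(w) exp (L(z) - L(w))\<close> with \<open>w = 1 - u + u z\<close>.\<close>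

context
  fixes P D :: "real fps"
  assumes P: "l1 P" and P1: "eval_fps P 1 = 1" and D: "D = fps_deriv L * P - fps_deriv P" "l1 D"
begin

definition flow :: "nat set \<Rightarrow> real \<Rightarrow> real" where
  "flow A u = (\<Sum>y\<in>A. (fps_expo L * thin u (fps_expo (- L) * P)) $ y)"

lemma l1_reduced: "l1 (fps_expo (- L) * P)"
  by (intro l1_mult l1_fps_expo P) (simp add: L)

text \<open>The integrating factor exp (-L) turns the operator P -> L' P - P' into plain
  differentiation, up to sign.\<close>

lemma reduced_deriv: "fps_deriv (fps_expo (- L) * P) = - (fps_expo (- L) * D)"
  by (simp add: fps_deriv_fps_expo L L' D(1) algebra_simps)

lemma flow_1: "flow A 1 = (\<Sum>y\<in>A. P $ y)"
  by (simp add: flow_def thin_1 mult.assoc[symmetric] fps_expo_uminus L)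

text \<open>At u = 0 thinning leaves the constant P(1) exp (-L(1)); \<open>P1\<close> makes it the
  normalisation of the compound Poisson law.\<close>

lemma flow_0: "flow A 0 = (\<Sum>y\<in>A. (fps_const (exp (- eval_fps L 1)) * fps_expo L) $ y)"
  by (simp add: flow_def thin_0 eval_mult_l1 l1_fps_expo L P P1 eval_fps_expo eval_uminus_l1 mult.commute)

lemma flow_deriv:
  assumes u: "0 \<le> u" "u \<le> 1"
  shows "(flow A has_field_derivative
    (\<Sum>y\<in>A. ((1 - fps_X) * (fps_expo (L - thin u L) * thin u D)) $ y)) (at u within {0..1})"
proof -
  have lE: "l1 (fps_expo (- L))" by (intro l1_fps_expo) (simp add: L)
  have lR': "l1 (fps_deriv (fps_expo (- L) * P))"
    unfolding reduced_deriv l1_uminus by (intro l1_mult lE D(2))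
  \<comment> \<open>Substitution is multiplicative: thinning exp (-L) D gives exp (-L(w)) D(w), and
    exp (L(z)) merges with the first factor.\<close>
  have th: "fps_expo L * thin u (- (fps_expo (- L) * D)) = - (fps_expo (L - thin u L) * thin u D)"
  proof (rule fps_eqI_eval)
    show "l1 (fps_expo L * thin u (- (fps_expo (- L) * D)))"
      by (intro l1_mult l1_fps_expo l1_thin L u) (simp only: l1_uminus l1_mult lE D(2))
    show "l1 (- (fps_expo (L - thin u L) * thin u D))"
      unfolding l1_uminus by (intro l1_mult l1_fps_expo l1_diff l1_thin L u D(2))
    fix z :: real assume z: "0 < z" "z < 1"
    define w where "w = 1 - u + u * z"
    have w: "\<bar>w\<bar> \<le> 1" "\<bar>z\<bar> \<le> 1"
      unfolding w_def using u z mult_nonneg_nonneg[of u z] mult_left_mono[of z 1 u] by auto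
    show "eval_fps (fps_expo L * thin u (- (fps_expo (- L) * D))) z
        = eval_fps (- (fps_expo (L - thin u L) * thin u D)) z"
      by (simp add: eval_mult_l1 eval_uminus_l1 eval_thin eval_diff_l1 eval_fps_expo
          l1_mult l1_fps_expo l1_thin l1_diff u w L D(2) exp_diff exp_minus w_def[symmetric] divide_inverse)
  qed
  have "((\<lambda>u. (fps_expo L * thin u (fps_expo (- L) * P)) $ y) has_field_derivative
      (fps_expo L * ((fps_X - 1) * thin u (fps_deriv (fps_expo (- L) * P)))) $ y) (at u within {0..1})" for y
    unfolding fps_mult_nth[of "fps_expo L"]
    by (intro DERIV_sum DERIV_cmult thin_nth_deriv l1_reduced lR' u)
  then have "(flow A has_field_derivative
    (\<Sum>y\<in>A. (fps_expo L * ((fps_X - 1) * thin u (fps_deriv (fps_expo (- L) * P)))) $ y)) (at u within {0..1})"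
    unfolding flow_def by (intro DERIV_sum)
  also have "fps_expo L * ((fps_X - 1) * thin u (fps_deriv (fps_expo (- L) * P)))
     = (fps_X - 1) * (fps_expo L * thin u (- (fps_expo (- L) * D)))"
    unfolding reduced_deriv by (simp only: mult_ac)
  also have "\<dots> = (1 - fps_X) * (fps_expo (L - thin u L) * thin u D)"
    unfolding th by (simp add: algebra_simps)
  finally show ?thesis .
qed

text \<open>\<open>g\<close> plus and minus the flow are both non-decreasing. Derivatives are asked
  for in the open interval only, because a multiple of -sqrt (1 - u) will serve as \<open>g\<close>,
  with infinite slope at u = 1.\<close>

lemma flow_bound_aux:
  assumes bound: "\<And>u. 0 < u \<Longrightarrow> u < 1 \<Longrightarrow> \<bar>\<Sum>y\<in>A. ((1 - fps_X) * (fps_expo (L - thin u L) * thin u D)) $ y\<bar> \<le> g' u"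
    and g: "continuous_on {0..1} g" "\<And>u. 0 < u \<Longrightarrow> u < 1 \<Longrightarrow> (g has_field_derivative g' u) (at u)"
  shows "\<bar>flow A 1 - flow A 0\<bar> \<le> g 1 - g 0"
proof -
  define f' where "f' u = (\<Sum>y\<in>A. ((1 - fps_X) * (fps_expo (L - thin u L) * thin u D)) $ y)" for u
  have cont: "continuous_on {0..1} (flow A)"
    using flow_deriv by (intro DERIV_continuous_on) auto
  have der: "(flow A has_field_derivative f' u) (at u)" if "0 < u" "u < 1" for u
    using flow_deriv[of u A] that by (simp add: f'_def at_within_Icc_at)
  have mono: "h 0 \<le> h 1" if "continuous_on {0..1} h"
    "\<And>u. 0 < u \<Longrightarrow> u < 1 \<Longrightarrow> (h has_field_derivative h' u) (at u)"
    "\<And>u. 0 < u \<Longrightarrow> u < 1 \<Longrightarrow> 0 \<le> h' u" for h h' :: "real \<Rightarrow> real"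
  proof (rule DERIV_nonneg_imp_increasing_open[of 0 1 h])
    show "\<exists>y. (h has_real_derivative y) (at u) \<and> 0 \<le> y" if "0 < u" "u < 1" for u
      using that \<open>\<And>u. 0 < u \<Longrightarrow> u < 1 \<Longrightarrow> (h has_field_derivative h' u) (at u)\<close>
        \<open>\<And>u. 0 < u \<Longrightarrow> u < 1 \<Longrightarrow> 0 \<le> h' u\<close> by blast
  qed (use that(1) in simp_all)
  have "g 0 - flow A 0 \<le> g 1 - flow A 1"
  proof (rule mono[where h' = "\<lambda>u. g' u - f' u"])
    show "continuous_on {0..1} (\<lambda>u. g u - flow A u)" by (intro continuous_on_diff g cont)
    fix u :: real assume u: "0 < u" "u < 1"
    show "((\<lambda>u. g u - flow A u) has_field_derivative g' u - f' u) (at u)"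
      by (intro DERIV_diff g der u)
    show "0 \<le> g' u - f' u" using bound[OF u] unfolding f'_def by linarith
  qed
  moreover have "g 0 + flow A 0 \<le> g 1 + flow A 1"
  proof (rule mono[where h' = "\<lambda>u. g' u + f' u"])
    show "continuous_on {0..1} (\<lambda>u. g u + flow A u)" by (intro continuous_on_add g cont)
    fix u :: real assume u: "0 < u" "u < 1"
    show "((\<lambda>u. g u + flow A u) has_field_derivative g' u + f' u) (at u)"
      by (intro DERIV_add g der u)
    show "0 \<le> g' u + f' u" using bound[OF u] unfolding f'_def by linarith
  qed
  ultimately show ?thesis by auto
qed

text \<open>Integration of the two smoothing bounds over [0, 1]: the constant 1 gives 1, and 1 / (2
  sqrt (\<open>\<theta>\<close> (1 - u))) has the primitive -sqrt (1 - u) / sqrt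
  \<open>\<theta>\<close>, which rises by 1 / sqrt \<open>\<theta>\<close>.\<close>

theorem monotone_stein_bound:
  assumes A: "finite A"
  shows "\<bar>\<Sum>y\<in>A. P $ y - (fps_const (exp (- eval_fps L 1)) * fps_expo L) $ y\<bar> \<le> l1_norm D"
    and "\<theta> > 0 \<Longrightarrow> \<bar>\<Sum>y\<in>A. P $ y - (fps_const (exp (- eval_fps L 1)) * fps_expo L) $ y\<bar> \<le> l1_norm D / sqrt \<theta>"
proof -
  have lT: "l1 (thin u D)" "l1_norm (thin u D) \<le> l1_norm D" if "0 < u" "u < 1" for u
    using that by (auto intro!: l1_thin l1_norm_thin D(2))
  have eq: "(\<Sum>y\<in>A. P $ y - (fps_const (exp (- eval_fps L 1)) * fps_expo L) $ y) = flow A 1 - flow A 0"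
    by (simp only: flow_0 flow_1 sum_subtractf)
  have "\<bar>flow A 1 - flow A 0\<bar> \<le> l1_norm D * 1 - l1_norm D * 0"
  proof (rule flow_bound_aux[where g = "\<lambda>u. l1_norm D * u" and g' = "\<lambda>_. l1_norm D"])
    fix u :: real assume u: "0 < u" "u < 1"
    show "\<bar>\<Sum>y\<in>A. ((1 - fps_X) * (fps_expo (L - thin u L) * thin u D)) $ y\<bar> \<le> l1_norm D"
      using immigration_smooth(1)[of u "thin u D" A] u lT[OF u] A by simp
    show "((\<lambda>u. l1_norm D * u) has_field_derivative l1_norm D) (at u)"
      using DERIV_cmult_Id by blast
  qed (intro continuous_intros)
  then show "\<bar>\<Sum>y\<in>A. P $ y - (fps_const (exp (- eval_fps L 1)) * fps_expo L) $ y\<bar> \<le> l1_norm D"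
    unfolding eq by simp
  have split: "N / (2 * (a * b)) = - (N / a) * (- inverse b / 2)" for N a b :: real
    unfolding inverse_eq_divide by simp
  assume \<theta>: "\<theta> > 0"
  have "\<bar>flow A 1 - flow A 0\<bar> \<le> - (l1_norm D / sqrt \<theta>) * sqrt (1 - 1) - - (l1_norm D / sqrt \<theta>) * sqrt (1 - 0)"
  proof (rule flow_bound_aux[where g = "\<lambda>u. - (l1_norm D / sqrt \<theta>) * sqrt (1 - u)"
        and g' = "\<lambda>u. - (l1_norm D / sqrt \<theta>) * (- inverse (sqrt (1 - u)) / 2)"])
    fix u :: real assume u: "0 < u" "u < 1"
    have "\<bar>\<Sum>y\<in>A. ((1 - fps_X) * (fps_expo (L - thin u L) * thin u D)) $ y\<bar>
        \<le> l1_norm (thin u D) / (2 * sqrt (\<theta> * (1 - u)))"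
    proof (rule immigration_smooth(2)[OF _ _ lT(1)[OF u] A])
      show "\<theta> * (1 - u) > 0" using \<theta> u by (intro mult_pos_pos) auto
    qed (use u in auto)
    also have "\<dots> \<le> l1_norm D / (2 * sqrt (\<theta> * (1 - u)))"
    proof (rule divide_right_mono[OF lT(2)[OF u]])
      show "0 \<le> 2 * sqrt (\<theta> * (1 - u))" using \<theta> u by (intro mult_nonneg_nonneg real_sqrt_ge_zero) auto
    qed
    also have "\<dots> = - (l1_norm D / sqrt \<theta>) * (- inverse (sqrt (1 - u)) / 2)"
      unfolding real_sqrt_mult by (rule split)
    finally show "\<bar>\<Sum>y\<in>A. ((1 - fps_X) * (fps_expo (L - thin u L) * thin u D)) $ y\<bar>
        \<le> - (l1_norm D / sqrt \<theta>) * (- inverse (sqrt (1 - u)) / 2)" .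
    show "((\<lambda>u. - (l1_norm D / sqrt \<theta>) * sqrt (1 - u)) has_field_derivative
        - (l1_norm D / sqrt \<theta>) * (- inverse (sqrt (1 - u)) / 2)) (at u)"
    proof (rule DERIV_cmult)
      have "((\<lambda>u. sqrt (1 - u)) has_field_derivative (inverse (sqrt (1 - u)) / 2) * (0 - 1)) (at u)"
        using u by (intro DERIV_chain2[where f = sqrt] DERIV_real_sqrt DERIV_diff DERIV_const DERIV_ident) simp
      then show "((\<lambda>u. sqrt (1 - u)) has_field_derivative - inverse (sqrt (1 - u)) / 2) (at u)" by simp
    qed
  qed (intro continuous_intros)
  then show "\<bar>\<Sum>y\<in>A. P $ y - (fps_const (exp (- eval_fps L 1)) * fps_expo L) $ y\<bar> \<le> l1_norm D / sqrt \<theta>"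
    unfolding eq by simp
qed

end

end

subsection \<open>Stein factor in the general case\<close>

definition fps_abs :: "real fps \<Rightarrow> real fps" where
  "fps_abs f = Abs_fps (\<lambda>n. \<bar>f $ n\<bar>)"

lemma fps_abs_nth [simp]: "fps_abs f $ n = \<bar>f $ n\<bar>"
  by (simp add: fps_abs_def)

lemma l1_fps_abs: "l1 (fps_abs f) \<longleftrightarrow> l1 f" and l1_norm_fps_abs: "l1_norm (fps_abs f) = l1_norm f"
  by (simp_all add: l1_def l1_norm_def)

text \<open>Unfolding the recursion \<open>L' b - b' = D\<close> at the coefficients, a majorant \<open>C\<close> of the
  fundamental solutions suffices.\<close>

lemma stein_recursion_bound:
  fixes L b C D :: "real fps"
  assumes L: "\<And>k. 0 \<le> L $ k" and C: "\<And>k. 0 \<le> C $ k" "1 \<le> C $ 0"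
    and C_rec: "\<And>k. (fps_deriv L * C) $ k \<le> real (k + 2) * C $ Suc k"
    and b: "fps_deriv L * b - fps_deriv b = D" "b $ 0 = 0"
  shows "\<bar>b $ n\<bar> \<le> (fps_X * (fps_abs D * C)) $ n"
proof (induction n rule: less_induct)
  case (less n)
  show ?case
  proof (cases n)
    case (Suc k)
    define B where "B = fps_X * (fps_abs D * C)"
    have L': "0 \<le> fps_deriv L $ i" for i using L by simp
    have "real (Suc k) * b $ Suc k = (fps_deriv L * b) $ k - D $ k"
      using arg_cong[OF b(1), of "\<lambda>f. f $ k"] by (simp add: algebra_simps)
    then have "real (Suc k) * \<bar>b $ Suc k\<bar> = \<bar>(fps_deriv L * b) $ k - D $ k\<bar>"
      by (metis abs_mult abs_of_nat)
    also have "\<dots> \<le> \<bar>(fps_deriv L * b) $ k\<bar> + \<bar>D $ k\<bar>" by (rule abs_triangle_ineq4)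
    also have "\<bar>(fps_deriv L * b) $ k\<bar> \<le> (\<Sum>i=0..k. fps_deriv L $ i * \<bar>b $ (k - i)\<bar>)"
      unfolding fps_mult_nth by (intro order_trans[OF sum_abs] sum_mono) (simp only: abs_mult abs_of_nonneg[OF L'] order_refl)
    also have "\<dots> \<le> (\<Sum>i=0..k. fps_deriv L $ i * B $ (k - i))"
      unfolding B_def by (intro sum_mono mult_left_mono less L') (simp add: Suc)
    also have "\<dots> = (fps_deriv L * B) $ k" by (simp only: fps_mult_nth)
    \<comment> \<open>Commutativity moves L' from the bound onto the majorant \<open>C\<close>,
      where \<open>C_rec\<close> applies.\<close>
    also have "(fps_deriv L * B) $ k = (fps_X * (fps_abs D * (fps_deriv L * C))) $ k"
      unfolding B_def by (simp only: mult_ac)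
    also have "(fps_X * (fps_abs D * (fps_deriv L * C))) $ k + \<bar>D $ k\<bar> \<le> real (Suc k) * (fps_abs D * C) $ k"
    proof (cases k)
      case 0
      then show ?thesis using mult_left_mono[OF C(2), of "\<bar>D $ 0\<bar>"] by (simp add: fps_mult_nth)
    next
      case (Suc j)
      have "(fps_abs D * (fps_deriv L * C)) $ j = (\<Sum>i=0..j. \<bar>D $ i\<bar> * (fps_deriv L * C) $ (j - i))"
        by (simp only: fps_mult_nth[of "fps_abs D"] fps_abs_nth)
      also have "\<dots> \<le> (\<Sum>i=0..j. \<bar>D $ i\<bar> * (real (Suc k) * C $ Suc (j - i)))"
      proof (intro sum_mono mult_left_mono)
        fix i
        have "(fps_deriv L * C) $ (j - i) \<le> real (j - i + 2) * C $ Suc (j - i)" by (rule C_rec)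
        \<comment> \<open>Since k = j + 1, the factor j - i + 2 is at most k + 1, with equality at i
          = 0; hence the constant k + 2 in \<open>C_rec\<close>.\<close>
        also have "\<dots> \<le> real (Suc k) * C $ Suc (j - i)"
          by (intro mult_right_mono C) (simp add: Suc)
        finally show "(fps_deriv L * C) $ (j - i) \<le> real (Suc k) * C $ Suc (j - i)" .
      qed simp
      also have "\<dots> = real (Suc k) * (\<Sum>i=0..j. \<bar>D $ i\<bar> * C $ (k - i))"
        unfolding sum_distrib_left by (intro sum.cong) (auto simp: Suc Suc_diff_le mult_ac)
      finally have "(fps_X * (fps_abs D * (fps_deriv L * C))) $ k \<le> real (Suc k) * (\<Sum>i=0..j. \<bar>D $ i\<bar> * C $ (k - i))"
        by (simp add: Suc)
      \<comment> \<open>The newest coefficient of \<open>D\<close> enters with weight 1, which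
        \<open>C $ 0\<close> \<ge> 1 absorbs.\<close>
      moreover have "1 * \<bar>D $ k\<bar> \<le> (real (Suc k) * C $ 0) * \<bar>D $ k\<bar>"
      proof (rule mult_right_mono)
        have "1 * 1 \<le> real (Suc k) * C $ 0" using C by (intro mult_mono) auto
        then show "1 \<le> real (Suc k) * C $ 0" by simp
      qed simp
      moreover have "(fps_abs D * C) $ k = (\<Sum>i=0..j. \<bar>D $ i\<bar> * C $ (k - i)) + \<bar>D $ k\<bar> * C $ 0"
        by (simp add: fps_mult_nth Suc)
      ultimately show ?thesis by (simp add: ring_distribs mult_ac)
    qed
    finally have "real (Suc k) * \<bar>b $ Suc k\<bar> \<le> real (Suc k) * (fps_abs D * C) $ k" by simp
    then have "\<bar>b $ Suc k\<bar> \<le> (fps_abs D * C) $ k"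
      by (simp only: mult_le_cancel_left_pos of_nat_0_less_iff zero_less_Suc)
    then show ?thesis by (simp add: Suc)
  qed (simp add: b)
qed

text \<open>Subtracting a multiple of exp L from \<open>P\<close> leaves \<open>D\<close> unchanged,
  since exp L solves the homogeneous equation; the multiple is chosen so that the recursion starts
  at 0. The compound Poisson law is another multiple of exp L, and comparing total masses relates
  the two.\<close>

lemma general_stein_bound_aux:
  assumes L: "l1 L" "l1 (fps_deriv L)" "\<And>k. 0 \<le> L $ k"
    and P: "l1 P" "eval_fps P 1 = 1" and D: "D = fps_deriv L * P - fps_deriv P" "l1 D"
    and C: "l1 C" "\<And>k. 0 \<le> C $ k" "1 \<le> C $ 0" "\<And>k. (fps_deriv L * C) $ k \<le> real (k + 2) * C $ Suc k"
    and A: "finite A"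
  shows "\<bar>\<Sum>y\<in>A. P $ y - (fps_const (exp (- eval_fps L 1)) * fps_expo L) $ y\<bar> \<le> l1_norm C * l1_norm D"
proof -
  define E where "E = fps_expo L"
  have E: "l1 E" "\<And>k. 0 \<le> E $ k" "fps_deriv E = fps_deriv L * E" "eval_fps E 1 = exp (eval_fps L 1)"
    using L by (simp_all add: E_def l1_fps_expo fps_expo_nonneg fps_deriv_fps_expo eval_fps_expo)
  have "E $ 0 = exp (L $ 0)"
    using eval_fps_expo[OF L(1), of 0] by (simp add: eval_fps_at_0 E_def)
  then have E0: "E $ 0 > 0" by simp
  define \<kappa> where "\<kappa> = P $ 0 / E $ 0"
  define b where "b = P - fps_const \<kappa> * E"
  define p where "p = (\<Sum>y\<in>A. (fps_const (exp (- eval_fps L 1)) * E) $ y)"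
  have lb: "l1 b" unfolding b_def by (intro l1_diff l1_mult P E) simp
  have bnd: "\<bar>b $ n\<bar> \<le> (fps_X * (fps_abs D * C)) $ n" for n
  proof (rule stein_recursion_bound[OF L(3) C(2-4)])
    show "fps_deriv L * b - fps_deriv b = D" by (simp add: b_def D(1) E(3) algebra_simps)
    show "b $ 0 = 0" using E0 by (simp add: b_def \<kappa>_def)
  qed
  have lXD: "l1 (fps_abs D * C)" by (intro l1_mult C) (simp add: l1_fps_abs D(2))
  have "l1_norm b \<le> l1_norm (fps_X * (fps_abs D * C))"
    using lb l1_mult[OF l1_X lXD] order_trans[OF bnd abs_ge_self]
    unfolding l1_norm_def l1_def by (intro suminf_le) auto
  also have "\<dots> \<le> 1 * l1_norm (fps_abs D * C)"
    using l1_norm_mult[OF l1_X lXD] by simp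
  also have "\<dots> \<le> l1_norm D * l1_norm C"
    using l1_norm_mult[of "fps_abs D" C] C D(2) by (simp add: l1_fps_abs l1_norm_fps_abs)
  finally have b_le: "l1_norm b \<le> l1_norm C * l1_norm D" by (simp add: mult.commute)
  have "eval_fps b 1 = 1 - \<kappa> * exp (eval_fps L 1)"
    unfolding b_def using P E by (simp add: eval_diff_l1 eval_mult_l1 l1_mult)
  then have \<kappa>: "\<kappa> = (1 - eval_fps b 1) * exp (- eval_fps L 1)"
    by (simp add: exp_minus field_simps)
  have "P $ y - (fps_const (exp (- eval_fps L 1)) * E) $ y = b $ y - eval_fps b 1 * (fps_const (exp (- eval_fps L 1)) * E) $ y" for y
    unfolding b_def[THEN arg_cong, of "\<lambda>f. f $ y"] by (simp add: \<kappa> algebra_simps)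
  then have eq: "(\<Sum>y\<in>A. P $ y - (fps_const (exp (- eval_fps L 1)) * E) $ y) = (\<Sum>y\<in>A. b $ y) - eval_fps b 1 * p"
    by (simp add: p_def sum_subtractf sum_distrib_left)
  have p0: "0 \<le> p" unfolding p_def using E(2) by (intro sum_nonneg) simp
  have p1: "p \<le> 1"
  proof -
    have "l1 (fps_const (exp (- eval_fps L 1)) * E)" by (intro l1_mult E) simp
    then have "p \<le> l1_norm (fps_const (exp (- eval_fps L 1)) * E)"
      using l1_nth_le[OF A, of "fps_const (exp (- eval_fps L 1)) * E"] E(2) by (simp add: p_def)
    also have "\<dots> = 1"
      using E by (subst l1_norm_nonneg_coeffs) (simp_all add: l1_mult eval_mult_l1 exp_add[symmetric])
    finally show ?thesis .
  qed
  define s where "s = (\<Sum>y\<in>A. b $ y)"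
  define t where "t = eval_fps b 1 - s"
  have "\<bar>s\<bar> \<le> (\<Sum>y\<in>A. \<bar>b $ y\<bar>)" unfolding s_def by (rule sum_abs)
  moreover have "\<bar>t\<bar> \<le> l1_norm b - (\<Sum>y\<in>A. \<bar>b $ y\<bar>)"
    unfolding t_def s_def by (rule l1_complement_le[OF lb A])
  ultimately have st: "\<bar>s\<bar> + \<bar>t\<bar> \<le> l1_norm b" by simp
  \<comment> \<open>With \<open>s\<close> the sum of \<open>b\<close> over \<open>A\<close> and
    \<open>t\<close> the sum outside, the weights 1 - p and p lie in [0, 1], so correcting the total
    mass costs no extra factor.\<close>
  have "s - eval_fps b 1 * p = s * (1 - p) - t * p" by (simp add: t_def algebra_simps)
  also have "\<bar>\<dots>\<bar> \<le> \<bar>s\<bar> * \<bar>1 - p\<bar> + \<bar>t\<bar> * \<bar>p\<bar>"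
    by (metis abs_mult abs_triangle_ineq4)
  also have "\<dots> \<le> \<bar>s\<bar> * 1 + \<bar>t\<bar> * 1"
    using p0 p1 by (intro add_mono mult_left_mono) auto
  finally show ?thesis using st b_le unfolding eq[unfolded E_def] s_def[symmetric] by simp
qed

text \<open>Two majorants: E = exp L itself, of norm exp (L(1)), and E without its constant term,
  shifted down and divided by \<open>L $ 1\<close>. Both satisfy the recursion because L' E =
  E'.\<close>

theorem general_stein_bound:
  assumes L: "l1 L" "l1 (fps_deriv L)" "\<And>k. 0 \<le> L $ k"
    and P: "l1 P" "eval_fps P 1 = 1" and D: "D = fps_deriv L * P - fps_deriv P" "l1 D"
    and A: "finite A"
  shows "\<bar>\<Sum>y\<in>A. P $ y - (fps_const (exp (- eval_fps L 1)) * fps_expo L) $ y\<bar> \<le> exp (eval_fps L 1) * l1_norm D"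
    and "L $ 1 > 0 \<Longrightarrow>
      \<bar>\<Sum>y\<in>A. P $ y - (fps_const (exp (- eval_fps L 1)) * fps_expo L) $ y\<bar> \<le> exp (eval_fps L 1) / L $ 1 * l1_norm D"
proof -
  define E where "E = fps_expo L"
  have E: "l1 E" "\<And>k. 0 \<le> E $ k" "fps_deriv E = fps_deriv L * E" "eval_fps E 1 = exp (eval_fps L 1)"
    using L by (simp_all add: E_def l1_fps_expo fps_expo_nonneg fps_deriv_fps_expo eval_fps_expo)
  have "E $ 0 = exp (L $ 0)"
    using eval_fps_expo[OF L(1), of 0] by (simp add: eval_fps_at_0 E_def)
  then have E0: "1 \<le> E $ 0" using L(3)[of 0] by simp
  have nE: "l1_norm E = exp (eval_fps L 1)" using E by (simp add: l1_norm_nonneg_coeffs)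
  have E': "(fps_deriv L * E) $ k = real (Suc k) * E $ Suc k" for k
    unfolding E(3)[symmetric] by simp
  have "(fps_deriv L * E) $ k \<le> real (k + 2) * E $ Suc k" for k
    unfolding E' using E(2) by (intro mult_right_mono) auto
  from general_stein_bound_aux[OF L P D E(1,2) E0 this A] nE
  show "\<bar>\<Sum>y\<in>A. P $ y - (fps_const (exp (- eval_fps L 1)) * fps_expo L) $ y\<bar> \<le> exp (eval_fps L 1) * l1_norm D"
    by simp
  assume L1: "L $ 1 > 0"
  define C where "C = fps_const (1 / L $ 1) * fps_shift 1 E"
  have lsh: "l1 (fps_shift 1 E)"
    using E(1) summable_ignore_initial_segment[of "\<lambda>i. \<bar>E $ i\<bar>" 1] by (simp add: l1_def)
  have lC: "l1 C" unfolding C_def by (intro l1_mult lsh) simp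
  have Cn: "C $ k = E $ Suc k / L $ 1" for k by (simp add: C_def)
  have C_nonneg: "0 \<le> C $ k" for k using E(2) L1 by (simp add: Cn)
  \<comment> \<open>This makes \<open>C $ 0\<close> equal to \<open>E $ 0\<close>, so the division
    by \<open>L $ 1\<close> does not spoil the lower bound 1.\<close>
  have "E $ 1 = L $ 1 * E $ 0" using E'[of 0] by simp
  then have C0: "1 \<le> C $ 0" using E0 L1 by (simp add: Cn)
  have C_rec: "(fps_deriv L * C) $ k \<le> real (k + 2) * C $ Suc k" for k
  proof -
    have "(fps_deriv L * C) $ k = (\<Sum>i=0..k. fps_deriv L $ i * E $ Suc (k - i)) / L $ 1"
      by (simp add: fps_mult_nth Cn sum_divide_distrib)
    also have "(\<Sum>i=0..k. fps_deriv L $ i * E $ Suc (k - i)) = (\<Sum>i=0..k. fps_deriv L $ i * E $ (Suc k - i))"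
      by (intro sum.cong) (auto simp: Suc_diff_le)
    \<comment> \<open>The added term i = k + 1 completes the convolution to the coefficient of E' at
      k + 1; the shift thus produces the factor k + 2.\<close>
    also have "\<dots> \<le> (\<Sum>i=0..Suc k. fps_deriv L $ i * E $ (Suc k - i))"
      using L(3) E(2) by (intro sum_mono2) auto
    also have "\<dots> = real (k + 2) * E $ Suc (Suc k)"
      using E'[of "Suc k"] by (simp only: fps_mult_nth) simp
    finally show ?thesis using L1 by (simp add: Cn divide_right_mono)
  qed
  have "l1_norm (fps_shift 1 E) \<le> l1_norm E"
    using E(1) suminf_split_initial_segment[of "\<lambda>i. \<bar>E $ i\<bar>" 1] by (simp add: l1_norm_def l1_def)
  then have "1 / L $ 1 * l1_norm (fps_shift 1 E) \<le> 1 / L $ 1 * exp (eval_fps L 1)"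
    using nE L1 by (intro mult_left_mono) auto
  moreover have "l1_norm C \<le> 1 / L $ 1 * l1_norm (fps_shift 1 E)"
    using l1_norm_mult[OF l1_const lsh, of "1 / L $ 1"] L1 unfolding C_def by simp
  ultimately have "l1_norm C \<le> exp (eval_fps L 1) / L $ 1" by simp
  then have "l1_norm C * l1_norm D \<le> exp (eval_fps L 1) / L $ 1 * l1_norm D"
    by (intro mult_right_mono l1_norm_nonneg D(2))
  with general_stein_bound_aux[OF L P D lC C_nonneg C0 C_rec A]
  show "\<bar>\<Sum>y\<in>A. P $ y - (fps_const (exp (- eval_fps L 1)) * fps_expo L) $ y\<bar> \<le> exp (eval_fps L 1) / L $ 1 * l1_norm D"
    by linarith
qed

subsection \<open>Sums of independent Bernoulli multiples\<close>

text \<open>For probabilities p_i, \<open>w I J\<close> is the probability that B_i = 1 exactly for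
  i in \<open>J\<close>, and \<open>s I J\<close> is the score there, since p (1 - 1 / (1 - p)) =
  -p^2 / (1 - p). Each summand has mean p^2 - p^2 = 0 and variance p^3 + p^4 / (1 - p) = p^3 / (1 -
  p).\<close>

lemma bernoulli_score_second_moment:
  fixes p :: "'i \<Rightarrow> real"
  assumes "finite I" "\<And>i. i \<in> I \<Longrightarrow> p i \<noteq> 1"
  defines "w \<equiv> \<lambda>I J. (\<Prod>i\<in>J. p i) * (\<Prod>i\<in>I - J. 1 - p i)"
    and "s \<equiv> \<lambda>I J. \<Sum>i\<in>I. if i \<in> J then p i else - (p i)\<^sup>2 / (1 - p i)"
  shows "(\<Sum>J\<in>Pow I. w I J) = 1" and "(\<Sum>J\<in>Pow I. w I J * s I J) = 0"
    and "(\<Sum>J\<in>Pow I. w I J * (s I J)\<^sup>2) = (\<Sum>i\<in>I. (p i) ^ 3 / (1 - p i))"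
proof -
  have "(\<Sum>J\<in>Pow I. w I J) = 1 \<and> (\<Sum>J\<in>Pow I. w I J * s I J) = 0 \<and>
    (\<Sum>J\<in>Pow I. w I J * (s I J)\<^sup>2) = (\<Sum>i\<in>I. (p i) ^ 3 / (1 - p i))"
    using assms(1,2)
  proof (induction I rule: finite_induct)
    case empty
    then show ?case by (simp add: w_def s_def)
  next
    case (insert x I)
    then have IH: "(\<Sum>J\<in>Pow I. w I J) = 1" "(\<Sum>J\<in>Pow I. w I J * s I J) = 0"
      "(\<Sum>J\<in>Pow I. w I J * (s I J)\<^sup>2) = (\<Sum>i\<in>I. (p i) ^ 3 / (1 - p i))"
      and px: "1 - p x \<noteq> 0" by (auto dest: insert.prems)
    define a where "a = - (p x)\<^sup>2 / (1 - p x)"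
    have split: "(\<Sum>J\<in>Pow (insert x I). F J) = (\<Sum>J\<in>Pow I. F J + F (insert x J))" for F :: "'i set \<Rightarrow> real"
    proof -
      have "(\<Sum>J\<in>Pow (insert x I). F J) = (\<Sum>J\<in>Pow I. F J) + (\<Sum>J\<in>insert x ` Pow I. F J)"
        unfolding Pow_insert using insert.hyps by (intro sum.union_disjoint) auto
      also have "(\<Sum>J\<in>insert x ` Pow I. F J) = (\<Sum>J\<in>Pow I. F (insert x J))"
        using insert.hyps by (subst sum.reindex) (auto simp: inj_on_def)
      finally show ?thesis by (simp add: sum.distrib)
    qed
    have w0: "w (insert x I) J = (1 - p x) * w I J" if "J \<in> Pow I" for J
    proof -
      have "insert x I - J = insert x (I - J)" using that insert.hyps by auto
      then show ?thesis using insert.hyps by (simp add: w_def mult_ac)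
    qed
    have w1: "w (insert x I) (insert x J) = p x * w I J" if "J \<in> Pow I" for J
    proof -
      have "insert x I - insert x J = I - J" "x \<notin> J" "finite J"
        using that insert.hyps by (auto intro: finite_subset)
      then show ?thesis by (simp add: w_def mult_ac)
    qed
    have s0: "s (insert x I) J = s I J + a" if "J \<in> Pow I" for J
      using that insert.hyps by (auto simp: s_def a_def)
    have s1: "s (insert x I) (insert x J) = s I J + p x" if "J \<in> Pow I" for J
    proof -
      have "(\<Sum>i\<in>I. if i \<in> insert x J then p i else - (p i)\<^sup>2 / (1 - p i))
          = (\<Sum>i\<in>I. if i \<in> J then p i else - (p i)\<^sup>2 / (1 - p i))"
        using insert.hyps by (intro sum.cong) auto
      then show ?thesis using insert.hyps by (simp add: s_def)
    qed
    have a: "(1 - p x) * a = - (p x)\<^sup>2" "(1 - p x) * a\<^sup>2 + (p x) ^ 3 = (p x) ^ 3 / (1 - p x)"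
    proof -
      define v where "v = 1 - p x"
      have v: "v \<noteq> 0" "p x + v = 1" "a = - (p x)\<^sup>2 / v" using px by (simp_all add: v_def a_def)
      have "v * a\<^sup>2 + (p x) ^ 3 = (p x) ^ 3 * (p x + v) / v"
        using v(1) unfolding v(3) by (simp add: field_simps power2_eq_square power3_eq_cube)
      then show "(1 - p x) * a\<^sup>2 + (p x) ^ 3 = (p x) ^ 3 / (1 - p x)"
        unfolding v(2) by (simp add: v_def)
      show "(1 - p x) * a = - (p x)\<^sup>2" using v(1) unfolding v(3) by (simp add: v_def)
    qed
    have "(\<Sum>J\<in>Pow (insert x I). w (insert x I) J) = 1"
      using IH(1) by (simp add: split w0 w1 ring_distribs)
    moreover have "(\<Sum>J\<in>Pow (insert x I). w (insert x I) J * s (insert x I) J)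
        = (\<Sum>J\<in>Pow I. w I J * s I J + ((1 - p x) * a + p x * p x) * w I J)"
      unfolding split by (intro sum.cong) (simp_all add: w0 w1 s0 s1 algebra_simps)
    then have "(\<Sum>J\<in>Pow (insert x I). w (insert x I) J * s (insert x I) J) = 0"
      unfolding a by (simp add: IH(2) power2_eq_square)
    moreover have "(\<Sum>J\<in>Pow (insert x I). w (insert x I) J * (s (insert x I) J)\<^sup>2)
        = (\<Sum>i\<in>I. (p i) ^ 3 / (1 - p i)) + (p x) ^ 3 / (1 - p x)"
    proof -
      \<comment> \<open>The cross term carries the mean of the new summand, which is zero.\<close>
      have z: "2 * ((1 - p x) * a + p x * p x) = 0" unfolding a(1) power2_eq_square by simp
      have "(\<Sum>J\<in>Pow (insert x I). w (insert x I) J * (s (insert x I) J)\<^sup>2)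
        = (\<Sum>J\<in>Pow I. w I J * (s I J)\<^sup>2 + 2 * ((1 - p x) * a + p x * p x) * (w I J * s I J)
            + ((1 - p x) * a\<^sup>2 + (p x) ^ 3) * w I J)"
        unfolding split by (intro sum.cong) (simp_all add: w0 w1 s0 s1 algebra_simps power2_eq_square power3_eq_cube)
      also have "\<dots> = (\<Sum>J\<in>Pow I. w I J * (s I J)\<^sup>2) + (p x) ^ 3 / (1 - p x) * (\<Sum>J\<in>Pow I. w I J)"
        unfolding a(2) z mult_zero_left add_0_right sum.distrib sum_distrib_left[symmetric] ..
      finally show ?thesis unfolding IH mult_1_right .
    qed
    ultimately show ?case using insert.hyps by simp
  qed
  then show "(\<Sum>J\<in>Pow I. w I J) = 1" "(\<Sum>J\<in>Pow I. w I J * s I J) = 0"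
    "(\<Sum>J\<in>Pow I. w I J * (s I J)\<^sup>2) = (\<Sum>i\<in>I. (p i) ^ 3 / (1 - p i))" by auto
qed

text \<open>Expanding over the set \<open>J\<close> of indices with \<open>B\<^sub>i = 1\<close>, the sum becomes the
  conditional expectation of the score \<open>\<Sum>i. p\<^sub>i (1 - [B\<^sub>i = 0] / (1 - p\<^sub>i))\<close>, whose
  \<open>L\<^sup>1\<close> norm is bounded by its \<open>L\<^sup>2\<close> norm.\<close>

lemma leave_one_out_l1_bound:
  fixes p :: "'i \<Rightarrow> real" and G :: "'i \<Rightarrow> real fps"
  assumes I: "finite I" and p: "\<And>i. i \<in> I \<Longrightarrow> 0 \<le> p i \<and> p i < 1"
    and G: "\<And>i. i \<in> I \<Longrightarrow> l1 (G i)" "\<And>i. i \<in> I \<Longrightarrow> l1_norm (G i) \<le> 1"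
  defines "f \<equiv> \<lambda>i. fps_const (1 - p i) + fps_const (p i) * G i"
  shows "l1_norm (\<Sum>i\<in>I. fps_const (p i) * ((\<Prod>k\<in>I. f k) - (\<Prod>k\<in>I - {i}. f k)))
           \<le> sqrt (\<Sum>i\<in>I. (p i) ^ 3 / (1 - p i))"
proof -
  define w where "w J = (\<Prod>i\<in>J. p i) * (\<Prod>i\<in>I - J. 1 - p i)" for J
  define s where "s J = (\<Sum>i\<in>I. if i \<in> J then p i else - (p i)\<^sup>2 / (1 - p i))" for J
  define V where "V = (\<Sum>i\<in>I. (p i) ^ 3 / (1 - p i))"
  define H where "H J = (\<Prod>i\<in>J. G i)" for J
  have w_nonneg: "0 \<le> w J" if "J \<in> Pow I" for J
    unfolding w_def using p that by (intro mult_nonneg_nonneg prod_nonneg) (auto simp: subset_iff less_imp_le)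
  have mom: "(\<Sum>J\<in>Pow I. w J) = 1" "(\<Sum>J\<in>Pow I. w J * (s J)\<^sup>2) = V"
    unfolding w_def s_def V_def using bernoulli_score_second_moment[OF I, of p] p by fastforce+
  have prod_const: "(\<Prod>i\<in>J. fps_const (c i)) = fps_const (\<Prod>i\<in>J. c i)" for J :: "'i set" and c :: "'i \<Rightarrow> real"
    by (induction J rule: infinite_finite_induct) auto
  have expand: "(\<Prod>k\<in>K. f k) = (\<Sum>J\<in>Pow K. fps_const ((\<Prod>i\<in>J. p i) * (\<Prod>i\<in>K - J. 1 - p i)) * H J)"
    if "finite K" for K
  proof -
    have "(\<Prod>k\<in>K. f k) = (\<Prod>k\<in>K. fps_const (p k) * G k + fps_const (1 - p k))"
      by (simp add: f_def add.commute)
    also have "\<dots> = (\<Sum>J\<in>Pow K. (\<Prod>i\<in>J. fps_const (p i) * G i) * (\<Prod>i\<in>K - J. fps_const (1 - p i)))"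
      by (rule prod_add[OF that])
    also have "\<dots> = (\<Sum>J\<in>Pow K. fps_const ((\<Prod>i\<in>J. p i) * (\<Prod>i\<in>K - J. 1 - p i)) * H J)"
      by (intro sum.cong refl) (simp only: prod.distrib prod_const H_def fps_const_mult[symmetric] mult_ac)
    finally show ?thesis .
  qed
  \<comment> \<open>Conditioning on B_i = 0: subsets containing i drop out, and the others are
    reweighted by 1 / (1 - p_i).\<close>
  have leave: "(\<Prod>k\<in>I - {i}. f k) = (\<Sum>J\<in>Pow I. fps_const (if i \<in> J then 0 else w J / (1 - p i)) * H J)"
    if i: "i \<in> I" for i
  proof -
    have "(\<Prod>k\<in>I - {i}. f k) = (\<Sum>J\<in>Pow (I - {i}). fps_const ((\<Prod>i\<in>J. p i) * (\<Prod>k\<in>I - {i} - J. 1 - p k)) * H J)"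
      using I by (intro expand) simp
    also have "\<dots> = (\<Sum>J\<in>Pow (I - {i}). fps_const (if i \<in> J then 0 else w J / (1 - p i)) * H J)"
    proof (intro sum.cong refl)
      fix J assume J: "J \<in> Pow (I - {i})"
      have "I - J = insert i (I - {i} - J)" using i J by auto
      then have "(\<Prod>k\<in>I - J. 1 - p k) = (1 - p i) * (\<Prod>k\<in>I - {i} - J. 1 - p k)"
        using I by simp
      then show "fps_const ((\<Prod>i\<in>J. p i) * (\<Prod>k\<in>I - {i} - J. 1 - p k)) * H J
         = fps_const (if i \<in> J then 0 else w J / (1 - p i)) * H J"
        using J p[OF i] by (auto simp: w_def)
    qed
    also have "\<dots> = (\<Sum>J\<in>Pow I. fps_const (if i \<in> J then 0 else w J / (1 - p i)) * H J)"
      using I by (intro sum.mono_neutral_left) auto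
    finally show ?thesis .
  qed
  have "(\<Sum>i\<in>I. fps_const (p i) * ((\<Prod>k\<in>I. f k) - (\<Prod>k\<in>I - {i}. f k)))
     = (\<Sum>i\<in>I. \<Sum>J\<in>Pow I. fps_const (w J * (if i \<in> J then p i else - (p i)\<^sup>2 / (1 - p i))) * H J)"
  proof (intro sum.cong refl)
    fix i assume i: "i \<in> I"
    have "fps_const (p i) * ((\<Prod>k\<in>I. f k) - (\<Prod>k\<in>I - {i}. f k))
      = (\<Sum>J\<in>Pow I. fps_const (p i) * (fps_const (w J) * H J - fps_const (if i \<in> J then 0 else w J / (1 - p i)) * H J))"
      unfolding leave[OF i] expand[OF I] w_def[symmetric] by (simp only: sum_subtractf sum_distrib_left right_diff_distrib)
    also have "\<dots> = (\<Sum>J\<in>Pow I. fps_const (w J * (if i \<in> J then p i else - (p i)\<^sup>2 / (1 - p i))) * H J)"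
    proof (intro sum.cong refl)
      fix J
      have "p i * (w J - (if i \<in> J then 0 else w J / (1 - p i))) = w J * (if i \<in> J then p i else - (p i)\<^sup>2 / (1 - p i))"
      proof (cases "i \<in> J")
        case False
        define v where "v = 1 - p i"
        have v: "v \<noteq> 0" "v - 1 = - p i" using p[OF i] by (auto simp: v_def)
        have diff: "w J - w J / v = w J * (v - 1) / v"
          using v(1) by (simp add: diff_divide_distrib right_diff_distrib)
        have "p i * (w J - w J / v) = w J * (- (p i)\<^sup>2 / v)"
          unfolding diff v(2) by (simp add: power2_eq_square)
        then show ?thesis using False by (simp only: v_def if_False)
      qed simp
      then have "fps_const (p i) * (fps_const (w J) - fps_const (if i \<in> J then 0 else w J / (1 - p i)))
        = fps_const (w J * (if i \<in> J then p i else - (p i)\<^sup>2 / (1 - p i)))"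
        by (simp only: fps_const_sub fps_const_mult)
      then show "fps_const (p i) * (fps_const (w J) * H J - fps_const (if i \<in> J then 0 else w J / (1 - p i)) * H J)
        = fps_const (w J * (if i \<in> J then p i else - (p i)\<^sup>2 / (1 - p i))) * H J"
        by (simp only: left_diff_distrib[symmetric] mult.assoc[symmetric])
    qed
    finally show "fps_const (p i) * ((\<Prod>k\<in>I. f k) - (\<Prod>k\<in>I - {i}. f k))
      = (\<Sum>J\<in>Pow I. fps_const (w J * (if i \<in> J then p i else - (p i)\<^sup>2 / (1 - p i))) * H J)" .
  qed
  also have "\<dots> = (\<Sum>J\<in>Pow I. fps_const (w J * s J) * H J)"
  proof (subst sum.swap, intro sum.cong refl)
    fix J
    have "(\<Sum>i\<in>K. fps_const (c i)) = fps_const (\<Sum>i\<in>K. c i)" for K :: "'i set" and c :: "'i \<Rightarrow> real"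
      by (induction K rule: infinite_finite_induct) auto
    then show "(\<Sum>i\<in>I. fps_const (w J * (if i \<in> J then p i else - (p i)\<^sup>2 / (1 - p i))) * H J) = fps_const (w J * s J) * H J"
      unfolding s_def sum_distrib_left by (simp only: sum_distrib_right[symmetric])
  qed
  finally have eq: "(\<Sum>i\<in>I. fps_const (p i) * ((\<Prod>k\<in>I. f k) - (\<Prod>k\<in>I - {i}. f k)))
     = (\<Sum>J\<in>Pow I. fps_const (w J * s J) * H J)" .
  have H: "l1 (H J)" "l1_norm (H J) \<le> 1" if "J \<in> Pow I" for J
    using that G unfolding H_def by (auto intro!: l1_prod l1_norm_prod_le_1)
  have "l1_norm (\<Sum>J\<in>Pow I. fps_const (w J * s J) * H J) \<le> (\<Sum>J\<in>Pow I. l1_norm (fps_const (w J * s J) * H J))"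
    by (intro l1_norm_sum l1_mult H) auto
  also have "\<dots> \<le> (\<Sum>J\<in>Pow I. w J * \<bar>s J\<bar>)"
  proof (rule sum_mono)
    fix J assume J: "J \<in> Pow I"
    have "l1_norm (fps_const (w J * s J) * H J) \<le> \<bar>w J * s J\<bar> * l1_norm (H J)"
      using l1_norm_mult[OF l1_const H(1)[OF J], of "w J * s J"] by simp
    also have "\<dots> \<le> \<bar>w J * s J\<bar> * 1" by (intro mult_left_mono H J) simp
    finally show "l1_norm (fps_const (w J * s J) * H J) \<le> w J * \<bar>s J\<bar>"
      using w_nonneg[OF J] by (simp add: abs_mult)
  qed
  also have "\<dots> \<le> sqrt V"
  proof (rule real_le_rsqrt)
    \<comment> \<open>One root of the weight carries the total mass 1, the other stays with the
      score.\<close>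
    have "(\<Sum>J\<in>Pow I. w J * \<bar>s J\<bar>)\<^sup>2 = (\<Sum>J\<in>Pow I. sqrt (w J) * (sqrt (w J) * \<bar>s J\<bar>))\<^sup>2"
      using w_nonneg by (intro arg_cong[where f = "\<lambda>x. x\<^sup>2"] sum.cong) (auto simp: mult.assoc[symmetric])
    also have "\<dots> \<le> (\<Sum>J\<in>Pow I. (sqrt (w J))\<^sup>2) * (\<Sum>J\<in>Pow I. (sqrt (w J) * \<bar>s J\<bar>)\<^sup>2)"
      by (rule Cauchy_Schwarz_ineq_sum)
    also have "\<dots> = (\<Sum>J\<in>Pow I. w J) * (\<Sum>J\<in>Pow I. w J * (s J)\<^sup>2)"
      using w_nonneg by (intro arg_cong2[where f = "(*)"] sum.cong) (auto simp: power_mult_distrib)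
    finally show "(\<Sum>J\<in>Pow I. w J * \<bar>s J\<bar>)\<^sup>2 \<le> V" by (simp add: mom)
  qed
  finally show ?thesis unfolding eq V_def .
qed

subsection \<open>Probability generating functions\<close>

definition pgf :: "nat pmf \<Rightarrow> real fps" where
  "pgf P = Abs_fps (pmf P)"

lemma pgf_nth [simp]: "pgf P $ n = pmf P n"
  by (simp add: pgf_def)

lemma expectation_nat_pmf_sums:
  fixes f :: "nat \<Rightarrow> real"
  assumes "integrable (measure_pmf P) f"
  shows "(\<lambda>n. pmf P n * f n) sums measure_pmf.expectation P f" and "summable (\<lambda>n. \<bar>pmf P n * f n\<bar>)"
proof -
  have "integrable (density (count_space UNIV) (\<lambda>x. ennreal (pmf P x))) f"
    using assms by (simp only: measure_pmf_eq_density[symmetric])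
  then have int: "integrable (count_space UNIV) (\<lambda>n. pmf P n * f n)"
    by (subst (asm) integrable_density) auto
  have "measure_pmf.expectation P f = (\<integral>n. pmf P n * f n \<partial>count_space UNIV)"
    by (subst measure_pmf_eq_density, subst integral_density) auto
  then show "(\<lambda>n. pmf P n * f n) sums measure_pmf.expectation P f"
    using sums_integral_count_space_nat[OF int] by simp
  show "summable (\<lambda>n. \<bar>pmf P n * f n\<bar>)"
    using int by (simp add: integrable_count_space_nat_iff)
qed

lemma integrable_power_pmf: "\<bar>z\<bar> \<le> 1 \<Longrightarrow> integrable (measure_pmf P) (\<lambda>n. z ^ n)" for z :: real
  using abs_power_le_1[of z] by (intro measure_pmf.integrable_const_bound[where B = 1]) auto

lemma l1_pgf [simp]: "l1 (pgf P)"
  using expectation_nat_pmf_sums(2)[OF integrable_power_pmf[of 1]] by (simp add: l1_def)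

lemma eval_pgf: "\<bar>z\<bar> \<le> 1 \<Longrightarrow> eval_fps (pgf P) z = measure_pmf.expectation P (\<lambda>n. z ^ n)"
  using expectation_nat_pmf_sums(1)[OF integrable_power_pmf] by (simp add: eval_fps_def sums_iff)

lemma eval_pgf_1 [simp]: "eval_fps (pgf P) 1 = 1"
  by (simp add: eval_pgf)

lemma l1_norm_pgf [simp]: "l1_norm (pgf P) = 1"
  using l1_norm_nonneg_coeffs[of "pgf P"] by simp

text \<open>Given Z = k the generating function is the k-th power of that of \<open>Q\<close>, and
  averaging over the Poisson weights sums an exponential series.\<close>

lemma pgf_compound_poisson:
  assumes lam: "0 < lam"
  shows "pgf (compound_poisson_pmf lam Q) = fps_const (exp (- lam)) * fps_expo (fps_const lam * pgf Q)"
proof (rule fps_eqI_eval)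
  have lL: "l1 (fps_const lam * pgf Q)" by (intro l1_mult) auto
  then show "l1 (fps_const (exp (- lam)) * fps_expo (fps_const lam * pgf Q))"
    by (intro l1_mult l1_fps_expo) auto
  fix z :: real assume z: "0 < z" "z < 1"
  then have z': "\<bar>z\<bar> \<le> 1" by simp
  define g where "g = measure_pmf.expectation Q (\<lambda>n. z ^ n)"
  have g0: "0 \<le> g" using z unfolding g_def by (intro Bochner_Integration.integral_nonneg) auto
  have "g \<le> 1" unfolding g_def using z
    by (intro measure_pmf.integral_le_const integrable_power_pmf z') (auto intro!: AE_pmfI power_le_one)
  with g0 have g: "\<bar>g\<bar> \<le> 1" by simp
  \<comment> \<open>With nonnegative integrals the mixture over Z is disintegrated without an
    integrability argument; z > 0 keeps the integrands nonnegative.\<close>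
  have nn: "(\<integral>\<^sup>+n. ennreal (z ^ n) \<partial>measure_pmf P) = ennreal (measure_pmf.expectation P (\<lambda>n. z ^ n))" for P :: "nat pmf"
    using z by (intro nn_integral_eq_integral integrable_power_pmf z') auto
  have cond: "measure_pmf.expectation (map_pmf (\<lambda>x. \<Sum>i=1..k. x i) (Pi_pmf {1..k} 0 (\<lambda>_. Q))) (\<lambda>n. z ^ n) = g ^ k" for k
  proof -
    have "measure_pmf.expectation (map_pmf (\<lambda>x. \<Sum>i=1..k. x i) (Pi_pmf {1..k} 0 (\<lambda>_. Q))) (\<lambda>n. z ^ n)
        = measure_pmf.expectation (Pi_pmf {1..k} 0 (\<lambda>_. Q)) (\<lambda>x. \<Prod>i\<in>{1..k}. z ^ x i)"
      by (simp add: power_sum)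
    also have "\<dots> = (\<Prod>i\<in>{1..k}. measure_pmf.expectation Q (\<lambda>n. z ^ n))"
      using z by (intro expectation_prod_Pi_pmf integrable_power_pmf z') auto
    finally show ?thesis by (simp add: g_def)
  qed
  have "ennreal (measure_pmf.expectation (compound_poisson_pmf lam Q) (\<lambda>n. z ^ n))
     = (\<integral>\<^sup>+k. ennreal (g ^ k) \<partial>measure_pmf (poisson_pmf lam))"
    unfolding nn[symmetric] compound_poisson_pmf_def nn_integral_bind_pmf unfolding nn cond ..
  also have "\<dots> = ennreal (measure_pmf.expectation (poisson_pmf lam) (\<lambda>k. g ^ k))"
    using g0 by (intro nn_integral_eq_integral integrable_power_pmf g) auto
  finally have "measure_pmf.expectation (compound_poisson_pmf lam Q) (\<lambda>n. z ^ n)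
     = measure_pmf.expectation (poisson_pmf lam) (\<lambda>k. g ^ k)"
    using z g0 by (subst (asm) ennreal_inj) (auto intro!: Bochner_Integration.integral_nonneg)
  also have "\<dots> = exp (- lam) * exp (lam * g)"
  proof (rule sums_unique2)
    show "(\<lambda>k. pmf (poisson_pmf lam) k * g ^ k) sums measure_pmf.expectation (poisson_pmf lam) (\<lambda>k. g ^ k)"
      by (intro expectation_nat_pmf_sums integrable_power_pmf g)
    have "(\<lambda>k. exp (- lam) * ((lam * g) ^ k /\<^sub>R fact k)) sums (exp (- lam) * exp (lam * g))"
      by (intro sums_mult exp_converges)
    also have "(\<lambda>k. exp (- lam) * ((lam * g) ^ k /\<^sub>R fact k)) = (\<lambda>k. pmf (poisson_pmf lam) k * g ^ k)"
      using lam by (simp add: power_mult_distrib divide_inverse mult_ac)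
    finally show "(\<lambda>k. pmf (poisson_pmf lam) k * g ^ k) sums (exp (- lam) * exp (lam * g))" .
  qed
  finally show "eval_fps (pgf (compound_poisson_pmf lam Q)) z
      = eval_fps (fps_const (exp (- lam)) * fps_expo (fps_const lam * pgf Q)) z"
    using z' lL by (simp add: eval_pgf eval_mult_l1 l1_fps_expo eval_fps_expo g_def)
qed simp

text \<open>In a countable type the points of measure zero form a null set, so almost every point is
  an atom; together with the full sigma-algebra this characterises a pmf.\<close>

lemma (in prob_space) distr_eq_measure_pmf:
  fixes S :: "'a \<Rightarrow> 'b :: countable"
  assumes S: "S \<in> measurable M (count_space UNIV)"
  obtains P where "distr M (count_space UNIV) S = measure_pmf P"
proof -
  define N where "N = distr M (count_space UNIV) S"
  interpret N: prob_space N unfolding N_def by (rule prob_space_distr[OF S])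
  have sets: "sets N = UNIV" by (simp add: N_def)
  have "AE x in N. \<forall>i. x = i \<longrightarrow> measure N {i} \<noteq> 0"
    unfolding AE_all_countable
  proof
    fix i :: 'b
    show "AE x in N. x = i \<longrightarrow> measure N {i} \<noteq> 0"
    proof (cases "measure N {i} = 0")
      case True
      then have "{i} \<in> null_sets N" by (simp add: null_sets_def N.emeasure_eq_measure sets)
      then have "AE x in N. x \<notin> {i}" by (rule AE_not_in)
      then show ?thesis by eventually_elim simp
    qed simp
  qed
  then have "AE x in N. measure N {x} \<noteq> 0" by eventually_elim simp
  then have "measure_pmf (Abs_pmf N) = N"
    using sets N.prob_space_axioms by (intro Abs_pmf_inverse) auto
  then show thesis using that[of "Abs_pmf N"] by (simp add: N_def)
qed

text \<open>Independence acts twice: across indices, after grouping X_i with B_i, to factor the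
  generating function of the sum, and within each pair, to separate B_i from z^X_i.\<close>

lemma (in prob_space) pgf_bernoulli_sum:
  fixes X B :: "'i \<Rightarrow> 'a \<Rightarrow> nat" and S :: "'a \<Rightarrow> nat"
  assumes I: "finite I" and p: "\<And>i. i \<in> I \<Longrightarrow> 0 \<le> p i \<and> p i \<le> 1"
    and indep: "indep_vars (\<lambda>_. count_space UNIV) (case_sum X B) (I <+> I)"
    and X: "\<And>i. i \<in> I \<Longrightarrow> distr M (count_space UNIV) (X i) = measure_pmf (Qs i)"
    and B: "\<And>i. i \<in> I \<Longrightarrow> distr M (count_space UNIV) (B i) = measure_pmf (map_pmf of_bool (bernoulli_pmf (p i)))"
    and S: "\<And>\<omega>. S \<omega> = (\<Sum>i\<in>I. B i \<omega> * X i \<omega>)"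
  obtains P where "distr M (count_space UNIV) S = measure_pmf P"
    "pgf P = (\<Prod>i\<in>I. fps_const (1 - p i) + fps_const (p i) * pgf (Qs i))"
proof -
  have rv: "random_variable (count_space UNIV) (case_sum X B j)" if "j \<in> I <+> I" for j
    using indep that unfolding indep_vars_def by blast
  have rvX [measurable]: "random_variable (count_space UNIV) (X i)" 
    and rvB [measurable]: "random_variable (count_space UNIV) (B i)" if "i \<in> I" for i
    using rv[of "Inl i"] rv[of "Inr i"] that by auto
  have "S = (\<lambda>\<omega>. \<Sum>i\<in>I. B i \<omega> * X i \<omega>)" using S by blast
  also have "\<dots> \<in> measurable M (count_space UNIV)" by measurable
  finally have rvS [measurable]: "random_variable (count_space UNIV) S" .
  obtain P where P: "distr M (count_space UNIV) S = measure_pmf P"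
    using distr_eq_measure_pmf[OF rvS] .
  have "pgf P = (\<Prod>i\<in>I. fps_const (1 - p i) + fps_const (p i) * pgf (Qs i))"
  proof (rule fps_eqI_eval)
    show "l1 (\<Prod>i\<in>I. fps_const (1 - p i) + fps_const (p i) * pgf (Qs i))"
      by (intro l1_prod l1_add l1_mult) auto
    fix z :: real assume z: "0 < z" "z < 1"
    then have z': "\<bar>z\<bar> \<le> 1" by simp
    define K where "K i = {Inl i, Inr i}" for i :: 'i
    have "indep_vars (\<lambda>i. PiM (K i) (\<lambda>_. count_space UNIV)) (\<lambda>i \<omega>. restrict (\<lambda>j. case_sum X B j \<omega>) (K i)) I"
      by (rule indep_vars_restrict[OF indep]) (auto simp: K_def disjoint_family_on_def)
    then have "indep_vars (\<lambda>_. borel) (\<lambda>i \<omega>. (\<lambda>h. z ^ (h (Inr i) * h (Inl i))) (restrict (\<lambda>j. case_sum X B j \<omega>) (K i))) I"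
    proof (rule indep_vars_compose2)
      fix i assume "i \<in> I"
      have [measurable]: "(\<lambda>h. h (Inl i)) \<in> measurable (PiM (K i) (\<lambda>_. count_space UNIV)) (count_space (UNIV :: nat set))"
        "(\<lambda>h. h (Inr i)) \<in> measurable (PiM (K i) (\<lambda>_. count_space UNIV)) (count_space (UNIV :: nat set))"
        by (auto intro!: measurable_component_singleton simp: K_def)
      show "(\<lambda>h. z ^ (h (Inr i) * h (Inl i))) \<in> borel_measurable (PiM (K i) (\<lambda>_. count_space UNIV))"
        by measurable
    qed
    then have indep': "indep_vars (\<lambda>_. borel) (\<lambda>i \<omega>. z ^ (B i \<omega> * X i \<omega>)) I"
      by (simp add: K_def)
    have int: "integrable M (\<lambda>\<omega>. z ^ (f \<omega>))" if [measurable]: "random_variable (count_space UNIV) f" for f :: "'a \<Rightarrow> nat"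
      using abs_power_le_1[OF z'] by (intro integrable_const_bound[where B = 1]) auto
    have single: "expectation (\<lambda>\<omega>. z ^ (B i \<omega> * X i \<omega>)) = 1 - p i + p i * eval_fps (pgf (Qs i)) z" if i: "i \<in> I" for i
    proof -
      note [measurable] = rvX[OF i] rvB[OF i]
      have "AE b in measure_pmf (map_pmf of_bool (bernoulli_pmf (p i))). b = 0 \<or> b = (1::nat)"
        by (rule AE_pmfI) (auto simp: of_bool_def split: if_splits)
      then have "AE b in distr M (count_space UNIV) (B i). b = 0 \<or> b = 1"
        unfolding B[OF i] .
      then have AE: "AE \<omega> in M. B i \<omega> = 0 \<or> B i \<omega> = 1"
        by (subst (asm) AE_distr_iff) auto
      define Z where "Z j \<omega> = (case j of Inl _ \<Rightarrow> z ^ X i \<omega> | Inr _ \<Rightarrow> real (B i \<omega>))" for j :: "'i + 'i" and \<omega>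
      have "indep_vars (\<lambda>_. count_space UNIV) (case_sum X B) (K i)"
        by (rule indep_vars_subset[OF indep]) (use i in \<open>auto simp: K_def\<close>)
      then have "indep_vars (\<lambda>_. borel) (\<lambda>j \<omega>. (case j of Inl _ \<Rightarrow> (\<lambda>x. z ^ x) | Inr _ \<Rightarrow> real) (case_sum X B j \<omega>)) (K i)"
        by (rule indep_vars_compose2) (auto split: sum.split)
      also have "?this \<longleftrightarrow> indep_vars (\<lambda>_. borel) Z (K i)"
        by (intro indep_vars_cong) (auto simp: K_def Z_def)
      finally have indZ: "indep_vars (\<lambda>_. borel) Z (K i)" .
      have intB: "integrable M (\<lambda>\<omega>. real (B i \<omega>))"
        using AE by (intro integrable_const_bound[where B = 1]) auto
      have intZ: "integrable M (Z j)" if "j \<in> K i" for j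
        using that int[OF rvX[OF i]] intB by (auto simp: K_def Z_def[abs_def])
      have prodZ: "(\<Prod>j\<in>K i. Z j \<omega>) = z ^ X i \<omega> * real (B i \<omega>)" for \<omega>
        by (simp add: K_def Z_def)
      have "expectation (\<lambda>\<omega>. \<Prod>j\<in>K i. Z j \<omega>) = (\<Prod>j\<in>K i. expectation (Z j))"
        by (rule indep_vars_lebesgue_integral[OF _ indZ intZ]) (simp add: K_def)
      then have e: "expectation (\<lambda>\<omega>. z ^ X i \<omega> * real (B i \<omega>)) = expectation (\<lambda>\<omega>. z ^ X i \<omega>) * expectation (\<lambda>\<omega>. real (B i \<omega>))"
        unfolding prodZ by (simp add: K_def Z_def[abs_def])
      have intp: "integrable M (\<lambda>\<omega>. z ^ X i \<omega> * real (B i \<omega>))"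
        using indep_vars_integrable[OF _ indZ intZ] unfolding prodZ by (simp add: K_def)
      have "expectation (\<lambda>\<omega>. real (B i \<omega>)) = (\<integral>b. real b \<partial>distr M (count_space UNIV) (B i))"
        by (subst integral_distr) auto
      also have "\<dots> = p i" using p[OF i] by (simp add: B[OF i])
      finally have eB: "expectation (\<lambda>\<omega>. real (B i \<omega>)) = p i" .
      have "expectation (\<lambda>\<omega>. z ^ X i \<omega>) = (\<integral>x. z ^ x \<partial>distr M (count_space UNIV) (X i))"
        by (subst integral_distr) auto
      then have eX: "expectation (\<lambda>\<omega>. z ^ X i \<omega>) = eval_fps (pgf (Qs i)) z"
        by (simp add: X[OF i] eval_pgf z')
      \<comment> \<open>For b in {0, 1} the power z^(b x) is 1 - b + z^x b; this linearisation holds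
        almost surely.\<close>
      have "expectation (\<lambda>\<omega>. z ^ (B i \<omega> * X i \<omega>)) = expectation (\<lambda>\<omega>. 1 - real (B i \<omega>) + z ^ X i \<omega> * real (B i \<omega>))"
        using AE by (intro integral_cong_AE) auto
      also have "\<dots> = 1 - p i + eval_fps (pgf (Qs i)) z * p i"
        using intB intp by (simp add: e eB eX prob_space)
      finally show ?thesis by simp
    qed
    have "eval_fps (pgf P) z = (\<integral>x. z ^ x \<partial>distr M (count_space UNIV) S)"
      by (simp add: P eval_pgf z')
    also have "\<dots> = expectation (\<lambda>\<omega>. z ^ S \<omega>)" by (subst integral_distr) auto
    also have "\<dots> = expectation (\<lambda>\<omega>. \<Prod>i\<in>I. z ^ (B i \<omega> * X i \<omega>))"
      by (simp add: S power_sum)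
    also have "\<dots> = (\<Prod>i\<in>I. expectation (\<lambda>\<omega>. z ^ (B i \<omega> * X i \<omega>)))"
      by (rule indep_vars_lebesgue_integral[OF I indep']) (intro int, measurable)
    also have "\<dots> = (\<Prod>i\<in>I. 1 - p i + p i * eval_fps (pgf (Qs i)) z)"
      by (intro prod.cong refl single)
    also have "\<dots> = eval_fps (\<Prod>i\<in>I. fps_const (1 - p i) + fps_const (p i) * pgf (Qs i)) z"
    proof -
      have l: "l1 (fps_const (1 - p i) + fps_const (p i) * pgf (Qs i))" for i
        by (intro l1_add l1_mult) auto
      show ?thesis
        using I by (induction I rule: finite_induct)
          (simp_all add: eval_mult_l1 eval_add_l1 l l1_prod l1_mult z')
    qed
    finally show "eval_fps (pgf P) z = eval_fps (\<Prod>i\<in>I. fps_const (1 - p i) + fps_const (p i) * pgf (Qs i)) z" .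
  qed simp
  with P show thesis by (rule that)
qed

subsection \<open>The Stein operator applied to the law of the sum\<close>

text \<open>The norm of the derivative is a first absolute moment: the mean q for the generating
  function of Q, and for the differences Q_i - Q the quantities that make up q D(Q).\<close>

lemma l1_norm_deriv_sums:
  assumes "summable (\<lambda>n. real n * \<bar>f $ n\<bar>)"
  shows "l1 (fps_deriv f)" and "(\<lambda>n. real n * \<bar>f $ n\<bar>) sums l1_norm (fps_deriv f)"
proof -
  have eq: "\<bar>fps_deriv f $ n\<bar> = real (Suc n) * \<bar>f $ Suc n\<bar>" for n by (simp add: abs_mult)
  have "summable (\<lambda>n. real (Suc n) * \<bar>f $ Suc n\<bar>)"
    using assms by (subst summable_Suc_iff)
  then show "l1 (fps_deriv f)" by (simp only: l1_def eq)
  then have "(\<lambda>n. real (Suc n) * \<bar>f $ Suc n\<bar>) sums l1_norm (fps_deriv f)"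
    unfolding l1_def l1_norm_def eq by (rule summable_sums)
  then show "(\<lambda>n. real n * \<bar>f $ n\<bar>) sums l1_norm (fps_deriv f)"
    by (subst (asm) sums_Suc_iff) simp
qed

lemma fps_deriv_prod_leave_one_out:
  fixes f :: "'i \<Rightarrow> real fps"
  assumes "finite I"
  shows "fps_deriv (\<Prod>i\<in>I. f i) = (\<Sum>i\<in>I. fps_deriv (f i) * (\<Prod>k\<in>I - {i}. f k))"
  using assms
proof (induction I rule: finite_induct)
  case (insert x I)
  have "(\<Sum>i\<in>I. fps_deriv (f i) * (\<Prod>k\<in>insert x I - {i}. f k)) = (\<Sum>i\<in>I. f x * (fps_deriv (f i) * (\<Prod>k\<in>I - {i}. f k)))"
  proof (intro sum.cong refl)
    fix i assume "i \<in> I"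
    then have "insert x I - {i} = insert x (I - {i})" using insert.hyps by auto
    then show "fps_deriv (f i) * (\<Prod>k\<in>insert x I - {i}. f k) = f x * (fps_deriv (f i) * (\<Prod>k\<in>I - {i}. f k))"
      using insert.hyps by (simp add: mult_ac)
  qed
  then show ?case using insert by (simp add: sum_distrib_left)
qed simp

text \<open>\<open>L\<close> is given in two forms: the sum matches the terms p_i G_i' in the
  derivative of \<open>P\<close>, while the multiple of \<open>Q\<close> lets the differences P -
  P_i be collected against the single factor Q'.\<close>

lemma stein_discrepancy_bound:
  fixes p :: "'i \<Rightarrow> real" and G :: "'i \<Rightarrow> real fps" and Q :: "real fps"
  assumes I: "finite I" and p: "\<And>i. i \<in> I \<Longrightarrow> 0 \<le> p i \<and> p i < 1"
    and G: "\<And>i. i \<in> I \<Longrightarrow> l1 (G i)" "\<And>i. i \<in> I \<Longrightarrow> l1_norm (G i) \<le> 1" "\<And>i. i \<in> I \<Longrightarrow> l1 (fps_deriv (G i))"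
    and Q: "l1 (fps_deriv Q)"
    and L: "L = (\<Sum>i\<in>I. fps_const (p i) * G i)" "L = fps_const (\<Sum>i\<in>I. p i) * Q"
    and P: "P = (\<Prod>i\<in>I. fps_const (1 - p i) + fps_const (p i) * G i)"
  shows "l1 (fps_deriv L * P - fps_deriv P)"
    and "l1_norm (fps_deriv L * P - fps_deriv P) \<le>
      l1_norm (fps_deriv Q) * sqrt (\<Sum>i\<in>I. (p i) ^ 3 / (1 - p i)) + (\<Sum>i\<in>I. p i * l1_norm (fps_deriv (G i - Q)))"
proof -
  define f where "f i = fps_const (1 - p i) + fps_const (p i) * G i" for i
  define R where "R i = (\<Prod>k\<in>I - {i}. f k)" for i
  define W where "W = (\<Sum>i\<in>I. fps_const (p i) * (P - R i))"
  define U where "U = (\<Sum>i\<in>I. fps_const (p i) * (fps_deriv (G i - Q) * R i))"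
  have P': "P = (\<Prod>i\<in>I. f i)" by (simp add: P f_def)
  have dP: "fps_deriv P = (\<Sum>i\<in>I. fps_const (p i) * (fps_deriv (G i) * R i))"
    unfolding P' fps_deriv_prod_leave_one_out[OF I] by (simp add: f_def R_def mult.assoc)
  have dL: "fps_deriv L = (\<Sum>i\<in>I. fps_const (p i) * fps_deriv (G i))"
    unfolding L(1) by (simp add: fps_deriv_sum)
  have dL': "fps_deriv L = (\<Sum>i\<in>I. fps_const (p i)) * fps_deriv Q"
  proof -
    have "fps_const (\<Sum>i\<in>I. p i) = (\<Sum>i\<in>I. fps_const (p i))"
      by (induction I rule: infinite_finite_induct) (auto simp: fps_const_add[symmetric] simp del: fps_const_add)
    then show ?thesis unfolding L(2) fps_deriv_mult_const_left by (simp only:)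
  qed
  have "fps_deriv Q * W - U = fps_deriv L * P - (\<Sum>i\<in>I. fps_const (p i) * (fps_deriv Q * R i)) - U"
    unfolding W_def dL' by (simp add: sum_distrib_left sum_distrib_right sum_subtractf algebra_simps)
  also have "\<dots> = fps_deriv L * P - fps_deriv P"
    unfolding U_def dP by (simp add: sum_subtractf[symmetric] sum.distrib[symmetric] algebra_simps)
  finally have eq: "fps_deriv L * P - fps_deriv P = fps_deriv Q * W - U" by simp
  have lf: "l1 (f i)" "l1_norm (f i) \<le> 1" if "i \<in> I" for i
  proof -
    have m: "l1 (fps_const (p i) * G i)" by (intro l1_mult G that) simp
    then show "l1 (f i)" unfolding f_def by (intro l1_add) auto
    have "l1_norm (fps_const (p i) * G i) \<le> \<bar>p i\<bar> * l1_norm (G i)"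
      using l1_norm_mult[OF l1_const G(1)[OF that], of "p i"] by simp
    also have "\<dots> \<le> \<bar>p i\<bar> * 1" by (intro mult_left_mono G that) simp
    finally show "l1_norm (f i) \<le> 1"
      using l1_norm_add[OF l1_const m, of "1 - p i"] p[OF that] by (simp add: f_def)
  qed
  have lR: "l1 (R i)" "l1_norm (R i) \<le> 1" for i
    unfolding R_def using lf by (auto intro!: l1_prod l1_norm_prod_le_1)
  have lP: "l1 P" unfolding P' using lf by (intro l1_prod)
  have lW: "l1 W" unfolding W_def by (intro l1_sum l1_mult l1_diff lP lR) simp
  have lW_le: "l1_norm W \<le> sqrt (\<Sum>i\<in>I. (p i) ^ 3 / (1 - p i))"
    unfolding W_def P R_def f_def by (rule leave_one_out_l1_bound[OF I p G(1,2)])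
  have lGQ: "l1 (fps_deriv (G i - Q))" if "i \<in> I" for i
    using l1_diff[OF G(3)[OF that] Q] by simp
  have lU: "l1 (fps_const (p i) * (fps_deriv (G i - Q) * R i))" if "i \<in> I" for i
    by (intro l1_mult lGQ lR that) simp
  have "l1_norm U \<le> (\<Sum>i\<in>I. l1_norm (fps_const (p i) * (fps_deriv (G i - Q) * R i)))"
    unfolding U_def by (intro l1_norm_sum lU)
  also have "\<dots> \<le> (\<Sum>i\<in>I. p i * l1_norm (fps_deriv (G i - Q)))"
  proof (rule sum_mono)
    fix i assume i: "i \<in> I"
    have "l1_norm (fps_const (p i) * (fps_deriv (G i - Q) * R i)) \<le> \<bar>p i\<bar> * l1_norm (fps_deriv (G i - Q) * R i)"
      using l1_norm_mult[OF l1_const[of "p i"] l1_mult(1)[OF lGQ[OF i] lR(1)[of i]]] by simp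
    also have "l1_norm (fps_deriv (G i - Q) * R i) \<le> l1_norm (fps_deriv (G i - Q)) * l1_norm (R i)"
      by (rule l1_norm_mult[OF lGQ[OF i] lR(1)])
    also have "\<dots> \<le> l1_norm (fps_deriv (G i - Q)) * 1"
      by (intro mult_left_mono lR l1_norm_nonneg lGQ i)
    finally show "l1_norm (fps_const (p i) * (fps_deriv (G i - Q) * R i)) \<le> p i * l1_norm (fps_deriv (G i - Q))"
      using p[OF i] by (simp add: mult_left_mono)
  qed
  finally have U: "l1_norm U \<le> (\<Sum>i\<in>I. p i * l1_norm (fps_deriv (G i - Q)))" .
  have lU': "l1 U" unfolding U_def by (intro l1_sum lU)
  have lQW: "l1 (fps_deriv Q * W)" by (intro l1_mult Q lW)
  show "l1 (fps_deriv L * P - fps_deriv P)" unfolding eq by (intro l1_diff lQW lU')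
  have "l1_norm (fps_deriv L * P - fps_deriv P) \<le> l1_norm (fps_deriv Q * W) + l1_norm U"
    unfolding eq by (rule l1_norm_diff[OF lQW lU'])
  also have "l1_norm (fps_deriv Q * W) \<le> l1_norm (fps_deriv Q) * l1_norm W" by (rule l1_norm_mult[OF Q lW])
  also have "\<dots> \<le> l1_norm (fps_deriv Q) * sqrt (\<Sum>i\<in>I. (p i) ^ 3 / (1 - p i))"
    by (intro mult_left_mono lW_le l1_norm_nonneg Q)
  finally show "l1_norm (fps_deriv L * P - fps_deriv P) \<le>
      l1_norm (fps_deriv Q) * sqrt (\<Sum>i\<in>I. (p i) ^ 3 / (1 - p i)) + (\<Sum>i\<in>I. p i * l1_norm (fps_deriv (G i - Q)))"
    using U by simp
qed

subsection \<open>Total variation and the Stein factor\<close>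

text \<open>Splitting a finite set by the sign of the difference gives two parts of absolute mass at
  most \<open>C\<close> each, and the factor 1/2 in the distance removes the 2.\<close>

lemma tv_dist_le:
  assumes "\<And>A. finite A \<Longrightarrow> \<bar>\<Sum>x\<in>A. pmf P x - pmf P' x\<bar> \<le> C"
  shows "tv_dist (measure_pmf P) (measure_pmf P') \<le> C"
proof -
  define d where "d x = pmf P x - pmf P' x" for x
  have C: "0 \<le> C" using assms[of "{}"] by simp
  have fin: "(\<Sum>x\<in>F. \<bar>d x\<bar>) \<le> 2 * C" if F: "finite F" for F
  proof -
    have "(\<Sum>x\<in>F. \<bar>d x\<bar>) = (\<Sum>x\<in>F \<inter> {x. 0 \<le> d x}. \<bar>d x\<bar>) + (\<Sum>x\<in>F \<inter> - {x. 0 \<le> d x}. \<bar>d x\<bar>)"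
      using F by (subst sum.union_disjoint[symmetric]) (auto intro!: sum.cong)
    also have "(\<Sum>x\<in>F \<inter> {x. 0 \<le> d x}. \<bar>d x\<bar>) = (\<Sum>x\<in>F \<inter> {x. 0 \<le> d x}. d x)"
      by (intro sum.cong) auto
    also have "(\<Sum>x\<in>F \<inter> - {x. 0 \<le> d x}. \<bar>d x\<bar>) = - (\<Sum>x\<in>F \<inter> - {x. 0 \<le> d x}. d x)"
      unfolding sum_negf[symmetric] by (intro sum.cong) auto
    finally show ?thesis
      using assms[of "F \<inter> {x. 0 \<le> d x}"] assms[of "F \<inter> - {x. 0 \<le> d x}"] F by (simp add: d_def abs_le_iff)
  qed
  have "(\<Sum>\<^sub>\<infinity>x. \<bar>d x\<bar>) \<le> 2 * C"
  proof (cases "(\<lambda>x. \<bar>d x\<bar>) summable_on UNIV")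
    case True
    then show ?thesis by (rule infsum_le_finite_sums) (rule fin)
  next
    \<comment> \<open>A family that is not summable has \<open>infsum\<close> equal to 0 by
      convention, so \<open>C\<close> \<ge> 0 suffices.\<close>
    case False
    then show ?thesis using C by (simp add: infsum_not_exists)
  qed
  then show ?thesis by (simp add: tv_dist_def d_def pmf.rep_eq)
qed

lemma stein_factor_nonneg:
  assumes "0 < lam" shows "0 \<le> stein_factor lam Q"
proof (cases "\<forall>j\<ge>1. real (j + 1) * pmf Q (j + 1) \<le> real j * pmf Q j")
  case True
  have "2 * pmf Q 2 \<le> pmf Q 1"
    using True[rule_format, of 1] by (simp add: numeral_2_eq_2)
  then have "0 \<le> 1 / (lam * (pmf Q 1 - 2 * pmf Q 2))" using assms by simp
  moreover have "0 \<le> sqrt d * (2 - sqrt d)" if "0 \<le> d" "\<not> d \<ge> 1" for d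
  proof -
    have "sqrt d \<le> 1" using that by simp
    then have "0 \<le> 2 - sqrt d" by linarith
    with that show ?thesis by (intro mult_nonneg_nonneg real_sqrt_ge_zero)
  qed
  ultimately show ?thesis
    using True by (simp add: stein_factor_def Let_def del: One_nat_def)
next
  case False
  then show ?thesis using assms unfolding stein_factor_def if_not_P[OF False] by simp
qed

lemma stein_factor_bound:
  assumes lam: "0 < lam" and Q: "pmf Q 0 = 0" and L: "L = fps_const lam * pgf Q" "l1 (fps_deriv L)"
    and D: "D = fps_deriv L * pgf P - fps_deriv (pgf P)" "l1 D"
    and A: "finite A"
  shows "\<bar>\<Sum>x\<in>A. pmf P x - pmf (compound_poisson_pmf lam Q) x\<bar> \<le> stein_factor lam Q * l1_norm D"
proof -
  have lL: "l1 L" unfolding L by (intro l1_mult) auto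
  have L_nth: "L $ k = lam * pmf Q k" for k by (simp add: L)
  have L0: "0 \<le> L $ k" for k using lam by (simp add: L_nth)
  have L1: "eval_fps L 1 = lam" unfolding L by (simp add: eval_mult_l1)
  have D0: "0 \<le> l1_norm D" by (rule l1_norm_nonneg[OF D(2)])
  have cp: "pmf (compound_poisson_pmf lam Q) x = (fps_const (exp (- eval_fps L 1)) * fps_expo L) $ x" for x
    unfolding L1 unfolding L pgf_compound_poisson[OF lam, symmetric] by simp
  define T where "T = \<bar>\<Sum>x\<in>A. pgf P $ x - (fps_const (exp (- eval_fps L 1)) * fps_expo L) $ x\<bar>"
  have T: "\<bar>\<Sum>x\<in>A. pmf P x - pmf (compound_poisson_pmf lam Q) x\<bar> = T"
    unfolding T_def cp by simp
  show ?thesis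
  proof (cases "\<forall>j\<ge>1. real (j + 1) * pmf Q (j + 1) \<le> real j * pmf Q j")
    case True
    have "fps_deriv L $ Suc k \<le> fps_deriv L $ k" for k
    proof -
      have "real (Suc k + 1) * pmf Q (Suc k + 1) \<le> real (Suc k) * pmf Q (Suc k)" using True[rule_format, of "Suc k"] by simp
      then have "lam * (real (Suc k + 1) * pmf Q (Suc k + 1)) \<le> lam * (real (Suc k) * pmf Q (Suc k))"
        using lam by simp
      then show ?thesis by (simp add: L_nth algebra_simps)
    qed
    then interpret monotone_rates L
      by unfold_locales (use lL L L0 in auto)
    have \<theta>: "\<theta> = lam * (pmf Q 1 - 2 * pmf Q 2)"
      by (simp add: \<theta>_def L_nth numeral_2_eq_2 algebra_simps)
    note bound = monotone_stein_bound[OF l1_pgf eval_pgf_1 D A, folded T_def]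
    show ?thesis
    proof (cases "pmf Q 1 = 2 * pmf Q 2")
      case eq: True
      \<comment> \<open>Here \<open>\<theta>\<close> = 0, corresponding to \<delta> = +\<infinity>,
        and the bound with constant 1 is the one that applies.\<close>
      then show ?thesis using True bound(1) by (simp add: T stein_factor_def)
    next
      case False
      then have \<theta>_pos: "0 < \<theta>" using \<theta>_nonneg lam unfolding \<theta> by (simp add: less_le)
      define c where "c = sqrt (1 / \<theta>)"
      have H: "stein_factor lam Q = (if 1 / \<theta> \<ge> 1 then 1 else c * (2 - c))"
        using True False by (simp add: stein_factor_def \<theta> c_def Let_def)
      have "T \<le> l1_norm D / sqrt \<theta>" using bound(2) \<theta>_pos by simp
      then have Tc: "T \<le> c * l1_norm D" by (simp add: c_def real_sqrt_divide)
      show ?thesis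
      proof (cases "1 / \<theta> \<ge> 1")
        case True
        then show ?thesis using bound(1) by (simp add: T H)
      next
        case False
        then have "c \<le> 1" "0 \<le> c" using \<theta>_pos by (auto simp: c_def)
        then have "c * 1 \<le> c * (2 - c)" by (intro mult_left_mono) auto
        then have "c * l1_norm D \<le> c * (2 - c) * l1_norm D"
          using D0 by (intro mult_right_mono) auto
        then show ?thesis using Tc False by (simp add: T H)
      qed
    qed
  next
    case False
    note bound = general_stein_bound[OF lL L(2) L0 l1_pgf eval_pgf_1 D A, folded T_def]
    have b1: "T \<le> exp lam * l1_norm D" using bound(1) by (simp add: L1)
    show ?thesis
    proof (cases "pmf Q 1 = 0")
      case True
      have "stein_factor lam Q = exp lam" unfolding stein_factor_def if_not_P[OF False] using True by simp
      then show ?thesis using b1 by (simp add: T)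
    next
      case nz: False
      then have "0 < lam * pmf Q 1" using lam by (simp add: pmf_pos)
      then have b2: "T \<le> exp lam * (1 / (lam * pmf Q 1)) * l1_norm D"
        using bound(2) by (simp add: L1 L_nth)
      have "stein_factor lam Q = exp lam * min 1 (1 / (lam * pmf Q 1))"
        unfolding stein_factor_def if_not_P[OF False] using nz by simp
      then show ?thesis using b1 b2 by (simp add: T min_def)
    qed
  qed
qed

theorem theorem1p2:
  fixes n :: nat and p :: "nat \<Rightarrow> real" and Qs :: "nat \<Rightarrow> nat pmf" and qs :: "nat \<Rightarrow> real"
    and M :: "'a measure" and X B Y :: "nat \<Rightarrow> 'a \<Rightarrow> nat" and S :: "'a \<Rightarrow> nat"
    and lam q D :: real and Q :: "nat pmf"
  assumes n: "1 \<le> n"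
    and p: "\<And>i. i \<in> {1..n} \<Longrightarrow> 0 < p i \<and> p i < 1"
    and Qs_support: "\<And>i. i \<in> {1..n} \<Longrightarrow> pmf (Qs i) 0 = 0"
    and Qs_finite_mean: "\<And>i. i \<in> {1..n} \<Longrightarrow> integrable (measure_pmf (Qs i)) real"
    and qs: "\<And>i. i \<in> {1..n} \<Longrightarrow> qs i = measure_pmf.expectation (Qs i) real"
    and M: "prob_space M"
    and indep: "prob_space.indep_vars M (\<lambda>_. count_space UNIV) (case_sum X B) ({1..n} <+> {1..n})"
    and X_distr: "\<And>i. i \<in> {1..n} \<Longrightarrow> distr M (count_space UNIV) (X i) = measure_pmf (Qs i)"
    and B_distr: "\<And>i. i \<in> {1..n} \<Longrightarrow>
          distr M (count_space UNIV) (B i) = measure_pmf (map_pmf of_bool (bernoulli_pmf (p i)))"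
    and Y: "\<And>i \<omega>. Y i \<omega> = B i \<omega> * X i \<omega>"
    and S: "\<And>\<omega>. S \<omega> = (\<Sum>i=1..n. Y i \<omega>)"
    and lam: "lam = (\<Sum>i=1..n. p i)"
    and Q: "Q = mixture_pmf {1..n} (\<lambda>i. p i / lam) Qs"
    and q: "q = (\<Sum>i=1..n. p i / lam * qs i)"
    and D: "D = (\<Sum>\<^sub>\<infinity>j\<in>{1..}. \<Sum>i=1..n. real j * p i / q * \<bar>pmf (Qs i) j - pmf Q j\<bar>)"
  shows "tv_dist (distr M (count_space UNIV) S) (measure_pmf (compound_poisson_pmf lam Q))
           \<le> stein_factor lam Q * q * (sqrt (\<Sum>i=1..n. (p i) ^ 3 / (1 - p i)) + D)"
proof -
  interpret prob_space M by (rule M)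
  define I where "I = {1..n}"
  have I: "finite I" "I \<noteq> {}" using n by (auto simp: I_def)
  note p = p[folded I_def] and Qs_support = Qs_support[folded I_def]
    and Qs_finite_mean = Qs_finite_mean[folded I_def] and qs = qs[folded I_def]
  have lam_pos: "0 < lam" unfolding lam I_def[symmetric] using I p by (intro sum_pos) auto
  have Q_nth: "pmf Q x = (\<Sum>i\<in>I. p i / lam * pmf (Qs i) x)" for x
    unfolding Q I_def[symmetric]
  proof (rule pmf_mixture_pmf)
    show "(\<Sum>i\<in>I. p i / lam) = 1"
      using lam_pos by (simp add: sum_divide_distrib[symmetric] lam[folded I_def, symmetric])
  qed (use p lam_pos in \<open>auto intro: less_imp_le\<close>)
  have Q0: "pmf Q 0 = 0" unfolding Q_nth using Qs_support by simp
  have mean_Qs: "(\<lambda>j. real j * pmf (Qs i) j) sums qs i" if "i \<in> I" for i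
    using expectation_nat_pmf_sums(1)[OF Qs_finite_mean[OF that]] by (simp add: qs[OF that] mult.commute)
  have mean_Q: "(\<lambda>j. real j * pmf Q j) sums q"
  proof -
    have "(\<lambda>j. \<Sum>i\<in>I. p i / lam * (real j * pmf (Qs i) j)) sums (\<Sum>i\<in>I. p i / lam * qs i)"
      by (intro sums_sum sums_mult mean_Qs)
    then show ?thesis by (simp add: q[folded I_def] Q_nth sum_distrib_left mult_ac)
  qed
  \<comment> \<open>Positivity lets the division by \<open>q\<close> inside \<open>D\<close> cancel.
    It holds because \<open>Q\<close> has an atom, and every atom is a positive integer.\<close>
  have q_pos: "0 < q"
  proof -
    obtain j where j: "j \<in> set_pmf Q" using set_pmf_not_empty[of Q] by auto
    then have "pmf Q j \<noteq> 0" by (simp add: set_pmf_iff)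
    with Q0 have "0 < real j * pmf Q j" by (cases j) (auto simp: pmf_pos)
    also have "\<dots> = (\<Sum>k\<in>{j}. real k * pmf Q k)" by simp
    also have "\<dots> \<le> (\<Sum>k. real k * pmf Q k)"
      using mean_Q by (intro sum_le_suminf) (auto simp: sums_iff)
    also have "\<dots> = q" using mean_Q by (simp add: sums_iff)
    finally show ?thesis .
  qed
  have dQs: "l1 (fps_deriv (pgf (Qs i)))" if "i \<in> I" for i
    using mean_Qs[OF that] by (intro l1_norm_deriv_sums) (simp add: sums_iff)
  have dQ: "l1 (fps_deriv (pgf Q))" "l1_norm (fps_deriv (pgf Q)) = q"
    using l1_norm_deriv_sums[of "pgf Q"] mean_Q by (auto simp: sums_iff)
  obtain P where P: "distr M (count_space UNIV) S = measure_pmf P"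
    "pgf P = (\<Prod>i\<in>I. fps_const (1 - p i) + fps_const (p i) * pgf (Qs i))"
  proof (rule pgf_bernoulli_sum[of I p X B Qs S])
    show "S \<omega> = (\<Sum>i\<in>I. B i \<omega> * X i \<omega>)" for \<omega> by (simp add: S Y I_def)
  qed (use I p indep X_distr B_distr in \<open>auto simp: I_def less_imp_le\<close>)
  define L where "L = fps_const lam * pgf Q"
  have L_sum: "L = (\<Sum>i\<in>I. fps_const (p i) * pgf (Qs i))"
    using lam_pos by (intro fps_ext) (simp add: L_def Q_nth fps_sum_nth sum_distrib_left)
  have L_lam: "L = fps_const (\<Sum>i\<in>I. p i) * pgf Q" by (simp add: L_def lam I_def)
  have dL: "l1 (fps_deriv L)" unfolding L_def using dQ by (simp add: l1_mult)
  define E where "E = fps_deriv L * pgf P - fps_deriv (pgf P)"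
  have E: "l1 E" "l1_norm E \<le> q * sqrt (\<Sum>i\<in>I. (p i) ^ 3 / (1 - p i))
      + (\<Sum>i\<in>I. p i * l1_norm (fps_deriv (pgf (Qs i) - pgf Q)))"
    unfolding E_def dQ(2)[symmetric]
    by (rule stein_discrepancy_bound[OF I(1) _ _ _ dQs dQ(1) L_sum L_lam P(2)]; use p in \<open>auto intro: less_imp_le\<close>)+
  have "(\<Sum>i\<in>I. p i * l1_norm (fps_deriv (pgf (Qs i) - pgf Q))) = q * D"
  proof -
    define t where "t j = (\<Sum>i\<in>I. real j * p i / q * \<bar>pmf (Qs i) j - pmf Q j\<bar>)" for j
    have t0: "0 \<le> t j" for j unfolding t_def using p q_pos by (intro sum_nonneg) (simp add: less_imp_le)
    have "(\<lambda>j. real j * \<bar>pmf (Qs i) j - pmf Q j\<bar>) sums l1_norm (fps_deriv (pgf (Qs i) - pgf Q))" if "i \<in> I" for i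
    proof -
      have "summable (\<lambda>j. real j * \<bar>(pgf (Qs i) - pgf Q) $ j\<bar>)"
      proof (rule summable_comparison_test')
        show "summable (\<lambda>j. real j * pmf (Qs i) j + real j * pmf Q j)"
          using mean_Qs[OF that] mean_Q by (intro summable_add) (auto simp: sums_iff)
        show "norm (real j * \<bar>(pgf (Qs i) - pgf Q) $ j\<bar>) \<le> real j * pmf (Qs i) j + real j * pmf Q j" for j
          unfolding distrib_left[symmetric] by (simp add: abs_mult) (intro mult_left_mono, auto simp: abs_le_iff)
      qed
      from l1_norm_deriv_sums(2)[OF this] show ?thesis by simp
    qed
    then have "(\<lambda>j. \<Sum>i\<in>I. p i / q * (real j * \<bar>pmf (Qs i) j - pmf Q j\<bar>)) sums
        (\<Sum>i\<in>I. p i / q * l1_norm (fps_deriv (pgf (Qs i) - pgf Q)))"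
      by (intro sums_sum sums_mult)
    also have "(\<lambda>j. \<Sum>i\<in>I. p i / q * (real j * \<bar>pmf (Qs i) j - pmf Q j\<bar>)) = t"
      by (simp add: t_def fun_eq_iff mult_ac)
    finally have ts: "t sums (\<Sum>i\<in>I. p i / q * l1_norm (fps_deriv (pgf (Qs i) - pgf Q)))" .
    then have "(t has_sum (\<Sum>i\<in>I. p i / q * l1_norm (fps_deriv (pgf (Qs i) - pgf Q)))) UNIV"
      using t0 by (intro norm_summable_imp_has_sum) (auto simp: sums_iff)
    moreover have "(t has_sum D) {1..} \<longleftrightarrow> (t has_sum D) UNIV"
      by (intro has_sum_cong_neutral) (auto simp: t_def not_le)
    moreover have "D = infsum t {1..}" unfolding D t_def I_def ..
    \<comment> \<open>The factor j kills the term at 0, so the sum from 1 on is the sum over all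
      indices.\<close>
    moreover have "infsum t {1..} = infsum t UNIV"
      by (intro infsum_cong_neutral) (auto simp: t_def not_le)
    ultimately have "D = (\<Sum>i\<in>I. p i / q * l1_norm (fps_deriv (pgf (Qs i) - pgf Q)))"
      by (simp add: infsumI)
    then show ?thesis using q_pos by (simp add: sum_distrib_left)
  qed
  with E(2) have E_le: "l1_norm E \<le> q * (sqrt (\<Sum>i\<in>I. (p i) ^ 3 / (1 - p i)) + D)"
    by (simp add: distrib_left)
  have "tv_dist (measure_pmf P) (measure_pmf (compound_poisson_pmf lam Q)) \<le> stein_factor lam Q * l1_norm E"
    by (intro tv_dist_le stein_factor_bound[OF lam_pos Q0 L_def dL E_def E(1)])
  also have "\<dots> \<le> stein_factor lam Q * (q * (sqrt (\<Sum>i\<in>I. (p i) ^ 3 / (1 - p i)) + D))"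
    by (intro mult_left_mono E_le stein_factor_nonneg lam_pos)
  finally show ?thesis by (simp add: P(1) I_def mult.assoc)
qed

end
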